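(* The hypergeometric group $\Gamma(\alpha,\beta)\subseteq\mathrm{GL}_5(\mathbb{Z})$ associated to the pair of parameters $\alpha=\left(0,\frac{1}{12},\frac{5}{12},\frac{7}{12},\frac{11}{12}\right)$, $\beta=\left(\frac{1}{2},\frac{1}{3},\frac{1}{3},\frac{2}{3},\frac{2}{3}\right)$ is arithmetic in the corresponding orthogonal group; that is, $\Gamma(\alpha,\beta)$ has finite index in $\mathrm{O}_{\mathrm{Q}}(\mathbb{Z})$, where $\mathrm{Q}$ is the non-degenerate quadratic form preserved by $\Gamma(\alpha,\beta)$.
   Context: Let $\alpha=(\alpha_1,\dots,\alpha_n),\ \beta=(\beta_1,\dots,\beta_n)\in\mathbb{C}^n$ with $\alpha_j-\beta_k\notin\mathbb{Z}$ for all $1\le j,k\le n$. Put $$f(x)=\prod_{j=1}^n\left(x-e^{2\pi i\alpha_j}\right)=x^n+a_{n-1}x^{n-1}+\cdots+a_1x+a_0,\qquad g(x)=\prod_{j=1}^n\left(x-e^{2\pi i\beta_j}\right)=x^n+b_{n-1}x^{n-1}+\cdots+b_1x+b_0 .$$ Let $A$ and $B$ be the companion matrices of $f$ and $g$: $A$ is the $n\times n$ matrix with $1$'s on the subdiagonal, last column $(-a_0,-a_1,\dots,-a_{n-1})^t$, and all other entries $0$; $B$ is defined likewise with last column $(-b_0,-b_1,\dots,-b_{n-1})^t$. The hypergeometric group is $\Gamma(\alpha,\beta)=\langle A,B\rangle\subseteq \mathrm{GL}_n(\mathbb{C})$ (the subgroup generated by $A$ and $B$). For the pair of parameters considered here $n=5$,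 $f(x)=(x-1)(x^4-x^2+1)$ and $g(x)=(x+1)(x^2+x+1)^2$. These are coprime products of cyclotomic polynomials forming a primitive pair (there are no $f_1,g_1\in\mathbb{Z}[x]$ and $k\ge 2$ with $f(x)=f_1(x^k)$, $g(x)=g_1(x^k)$), and $f(0)/g(0)=-1$. Hence $A,B\in\mathrm{GL}_5(\mathbb{Z})$. The group $\Gamma(\alpha,\beta)$ is infinite, and by a theorem of Beukers and Heckman it preserves a non-degenerate quadratic form $\mathrm{Q}$ on $\mathbb{Z}^5$ (with rational values; determined up to a scalar multiple) and is Zariski dense in the orthogonal group $\mathrm{O}_{\mathrm{Q}}$ of $\mathrm{Q}$. Here $\mathrm{O}_{\mathrm{Q}}(\mathbb{Z})=\{M\in\mathrm{GL}_5(\mathbb{Z}): M^t\,\mathrm{Q}\, M=\mathrm{Q}\}$, where $\mathrm{Q}$ also denotes the symmetric Gram matrix of the form in the standard basis. Arithmeticity: if $\mathrm{G}$ denotes the Zariski closure of a hypergeometric group $\Gamma\subseteq\mathrm{GL}_n(\mathbb{Z})$, so that $\Gamma\subseteq\mathrm{G}(\mathbb{Z})=\mathrm{G}\cap\mathrm{GL}_n(\mathbb{Z})$, then $\Gamma$ is called arithmetic if it has finite index in $\mathrm{G}(\mathbb{Z})$. *)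

theory Defs
  imports
    Complex_Main
    "HOL-Algebra.Coset"
    "HOL-Algebra.Generated_Groups"
    "HOL-Computational_Algebra.Polynomial"
    "Jordan_Normal_Form.Determinant"
begin

definition GL :: "nat \<Rightarrow> 'a::comm_ring_1 mat monoid" where
  "GL n = units_of (ring_mat TYPE('a) n ())"

text \<open>The copy of \<open>GL\<^sub>n(\<int>)\<close> inside \<open>GL\<^sub>n(\<complex>)\<close>: the inverse is integral as well.\<close>

definition GL_int :: "nat \<Rightarrow> complex mat set" where
  "GL_int n = map_mat of_int ` carrier (GL n :: int mat monoid)"

text \<open>Companion matrix of a monic polynomial of degree \<open>n > 0\<close>; rows and columns are numbered
  from 0.\<close>

definition companion_mat :: "'a::comm_ring_1 poly \<Rightarrow> 'a mat" where
  "companion_mat p = (let n = degree p in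
     mat n n (\<lambda>(i, j). if j = n - 1 then - coeff p i else if i = j + 1 then 1 else 0))"

definition param_poly :: "complex list \<Rightarrow> complex poly" where
  "param_poly \<alpha> = (\<Prod>a\<leftarrow>\<alpha>. [:- exp (2 * of_real pi * \<i> * a), 1:])"

text \<open>The parameter lists have the same length \<open>n\<close>.\<close>

definition hypergeometric_group :: "complex list \<Rightarrow> complex list \<Rightarrow> complex mat set" where
  "hypergeometric_group \<alpha> \<beta> =
     generate (GL (length \<alpha>)) {companion_mat (param_poly \<alpha>), companion_mat (param_poly \<beta>)}"

text \<open>A quadratic form on \<open>\<int>\<^sup>n\<close> with rational values is given by its symmetric Gram matrix \<open>Q\<close> in
  the standard basis.\<close>

definition nondegenerate_form :: "nat \<Rightarrow> rat mat \<Rightarrow> bool" where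
  "nondegenerate_form n Q \<longleftrightarrow> Q \<in> carrier_mat n n \<and> transpose_mat Q = Q \<and> det Q \<noteq> 0"

definition orthogonal_group :: "nat \<Rightarrow> rat mat \<Rightarrow> complex mat set" where
  "orthogonal_group n Q =
     {M \<in> carrier (GL n). transpose_mat M * map_mat of_rat Q * M = map_mat of_rat Q}"

definition orthogonal_group_int :: "nat \<Rightarrow> rat mat \<Rightarrow> complex mat monoid" where
  "orthogonal_group_int n Q = (GL n)\<lparr>carrier := orthogonal_group n Q \<inter> GL_int n\<rparr>"

definition finite_index_subgroup :: "'a set \<Rightarrow> ('a, 'b) monoid_scheme \<Rightarrow> bool" where
  "finite_index_subgroup H G \<longleftrightarrow> subgroup H G \<and> finite (rcosets\<^bsub>G\<^esub> H)"

end

theory Submission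
  imports Defs
begin

text \<open>In a suitable basis \<open>e\<^sub>1, e\<^sub>2, f\<^sub>1, f\<^sub>2, w\<close> of \<open>\<int>\<^sup>5\<close> the invariant form is \<open>9U \<oplus> 9U \<oplus> \<langle>1\<rangle>\<close>.
  Let \<open>O\<close> be its integral orthogonal group. The proof produces a set \<open>S \<subseteq> O\<close> such that
  (a) every element of \<open>O\<close> that is trivial modulo 2 lies in \<open>\<langle>S\<rangle>\<close> up to a diagonal sign matrix,
  and (b) a finite union \<open>\<Gamma>T\<close> of cosets is stable under right multiplication by \<open>S\<close>. Hence
  \<open>\<langle>S\<rangle> \<subseteq> \<Gamma>T\<close>, and since the elements trivial modulo 2 have finite index in \<open>O\<close>, so has \<open>\<Gamma>\<close>.

  For (a) one moves the columns of a given matrix to the basis vectors one after the other. On the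
  two hyperbolic planes, seen as integral \<open>2 \<times> 2\<close> matrices with the determinant as quadratic form,
  \<open>S\<close> contains generators of \<open>\<Gamma>(2) \<times> \<Gamma>(2)\<close>, so that the Euclidean algorithm applies; Eichler
  transvections remove the \<open>w\<close>-component. What remains is the orthogonal group of
  \<open>9U \<oplus> \<langle>1\<rangle>\<close>, essentially a Fuchsian group commensurable with the modular group, for which five
  further elements of \<open>S\<close> provide a descent.

  For (b), \<open>T\<close> has 24 elements and each of the \<open>13 \<cdot> 24\<close> inclusions amounts to some explicit matrix
  lying in \<open>\<Gamma>\<close>. Words for these matrices were found by a computer search.\<close>

subsection \<open>Matrices of size five\<close>

text \<open>No element of \<open>S\<close> has to lie in \<Gamma>: it is enough to know how it
  permutes finitely many cosets, so each table entry asks for one explicit word only. Level 2 suits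
  the Euclidean algorithm: one coordinate is odd and the other even, so their absolute values never
  coincide and subtracting an even multiple always makes progress. The price is a sign for each
  unit, because -1 and 1 agree modulo 2; hence the sign matrices. The vectors e1 and f1 can be
  reached by unipotent moves, since two hyperbolic planes are available. Once they are fixed, the
  transvections in the remaining rank one group do not decrease every isotropic vector. Seen on the
  cusps of the Fuchsian group, a move helps on an open interval where it lowers the denominator; the
  five further elements close the gaps between the intervals of the transvections, up to isolated
  points that no vector in question attains.\<close>

datatype vec5 = Vec int int int int int

text \<open>The five vectors are the columns. Explicit entries let the simplifier evaluate the many
  concrete products by plain rewriting.\<close>

datatype mat5 = Mat vec5 vec5 vec5 vec5 vec5

fun app :: "mat5 \<Rightarrow> vec5 \<Rightarrow> vec5" where
  "app (Mat (Vec a1 a2 a3 a4 a5) (Vec b1 b2 b3 b4 b5) (Vec c1 c2 c3 c4 c5) (Vec d1 d2 d3 d4 d5)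
      (Vec e1 e2 e3 e4 e5)) (Vec x1 x2 x3 x4 x5) =
    Vec (a1*x1 + b1*x2 + c1*x3 + d1*x4 + e1*x5) (a2*x1 + b2*x2 + c2*x3 + d2*x4 + e2*x5)
      (a3*x1 + b3*x2 + c3*x3 + d3*x4 + e3*x5) (a4*x1 + b4*x2 + c4*x3 + d4*x4 + e4*x5)
      (a5*x1 + b5*x2 + c5*x3 + d5*x4 + e5*x5)"

lemma mat5_cases:
  obtains a1 a2 a3 a4 a5 b1 b2 b3 b4 b5 c1 c2 c3 c4 c5 d1 d2 d3 d4 d5 e1 e2 e3 e4 e5
  where "g = Mat (Vec a1 a2 a3 a4 a5) (Vec b1 b2 b3 b4 b5) (Vec c1 c2 c3 c4 c5)
    (Vec d1 d2 d3 d4 d5) (Vec e1 e2 e3 e4 e5)"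
  by (metis mat5.exhaust vec5.exhaust)

instantiation mat5 :: monoid_mult
begin

definition one_mat5 :: mat5 where
  "1 = Mat (Vec 1 0 0 0 0) (Vec 0 1 0 0 0) (Vec 0 0 1 0 0) (Vec 0 0 0 1 0) (Vec 0 0 0 0 1)"

fun times_mat5 :: "mat5 \<Rightarrow> mat5 \<Rightarrow> mat5" where
  "g * Mat a b c d e = Mat (app g a) (app g b) (app g c) (app g d) (app g e)"

instance
proof
  fix g h k :: mat5
  have app_times: "app (g * h) v = app g (app h v)" for g h v
    by (cases g rule: mat5_cases; cases h rule: mat5_cases; cases v) (simp add: algebra_simps)
  show "g * h * k = g * (h * k)" by (cases k) (simp add: app_times)
  show "1 * g = g" by (cases g rule: mat5_cases) (simp add: one_mat5_def)
  show "g * 1 = g" by (cases g rule: mat5_cases) (simp add: one_mat5_def)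
qed

end

text \<open>The inverse of a matrix preserving the form. The last row has entries divisible by 9 in this
  case, otherwise the value is meaningless.\<close>

fun adj :: "mat5 \<Rightarrow> mat5" where
  "adj (Mat (Vec a1 a2 a3 a4 a5) (Vec b1 b2 b3 b4 b5) (Vec c1 c2 c3 c4 c5) (Vec d1 d2 d3 d4 d5)
      (Vec e1 e2 e3 e4 e5)) =
    Mat (Vec c3 d3 a3 b3 (9 * e3)) (Vec c4 d4 a4 b4 (9 * e4)) (Vec c1 d1 a1 b1 (9 * e1))
      (Vec c2 d2 a2 b2 (9 * e2)) (Vec (c5 div 9) (d5 div 9) (a5 div 9) (b5 div 9) e5)"

subsection \<open>Explicit elements of the hypergeometric group\<close>

text \<open>These are \<open>A\<close> and the reflection \<open>inverse A * B\<close> in the basis \<open>e\<^sub>1, e\<^sub>2, f\<^sub>1, f\<^sub>2, w\<close>.\<close>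

definition gA :: mat5 where
  "gA = Mat (Vec 1 (-2) (-2) (-1) 0) (Vec 1 (-1) (-1) (-1) 0) (Vec (-1) 1 0 0 0)
      (Vec 1 (-2) 0 0 0) (Vec 0 0 0 0 1)"

definition gC :: mat5 where
  "gC = Mat (Vec 3 (-6) (-2) 2 (-18)) (Vec (-2) 7 2 (-2) 18) (Vec (-2) 6 3 (-2) 18)
      (Vec 6 (-18) (-6) 7 (-54)) (Vec 2 (-6) (-2) 2 (-17))"

text \<open>Left multiplication by the two generators already yields a group, because
  \<open>gA ^ 12 = 1\<close> and \<open>gC\<close> is an involution.\<close>

inductive_set Gam :: "mat5 set" where
  Gam_one: "1 \<in> Gam"
| Gam_A: "g \<in> Gam \<Longrightarrow> gA * g \<in> Gam"
| Gam_C: "g \<in> Gam \<Longrightarrow> gC * g \<in> Gam"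

lemma Gam_mult: "g \<in> Gam \<Longrightarrow> h \<in> Gam \<Longrightarrow> g * h \<in> Gam"
  by (induction rule: Gam.induct) (auto simp: mult.assoc intro: Gam.intros)

lemma gA_power: "gA ^ 12 = 1"
  by (simp add: gA_def one_mat5_def eval_nat_numeral)

lemma gC_square: "gC * gC = 1"
  by (simp add: gC_def one_mat5_def)

lemma gA_in: "gA \<in> Gam" and gC_in: "gC \<in> Gam"
  using Gam_A [OF Gam_one] Gam_C [OF Gam_one] by simp_all

lemma Gam_power: "g \<in> Gam \<Longrightarrow> g ^ n \<in> Gam"
  by (induction n) (auto intro: Gam_one Gam_mult)

lemma Gam_inverse:
  assumes "g \<in> Gam"
  obtains g' where "g' \<in> Gam" "g * g' = 1" "g' * g = 1"
proof -
  have A: "gA * gA ^ 11 = 1" "gA ^ 11 * gA = 1"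
    using gA_power by (simp_all flip: power_Suc power_Suc2)
  have "\<exists>g'\<in>Gam. g * g' = 1 \<and> g' * g = 1" using assms
  proof induction
    case Gam_one
    show ?case using Gam.Gam_one by force
  next
    case (Gam_A g)
    then obtain g' where g': "g' \<in> Gam" "g * g' = 1" "g' * g = 1" by blast
    have "gA * g * (g' * gA ^ 11) = gA * (g * g') * gA ^ 11" "g' * gA ^ 11 * (gA * g) = g' * (gA ^ 11 * gA) * g"
      by (simp_all add: mult.assoc)
    then show ?case using g' A by (metis Gam_mult Gam_power gA_in mult_1_right)
  next
    case (Gam_C g)
    then obtain g' where g': "g' \<in> Gam" "g * g' = 1" "g' * g = 1" by blast
    have "gC * g * (g' * gC) = gC * (g * g') * gC" "g' * gC * (gC * g) = g' * (gC * gC) * g"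
      by (simp_all add: mult.assoc)
    then show ?case using g' gC_square by (metis Gam_mult gC_in mult_1_right)
  qed
  then show ?thesis using that by blast
qed

text \<open>Inverses are unique and stay in \<open>Gam\<close>, so one check of
  \<open>g * adj g = 1\<close> makes the closed formula \<open>adj\<close> usable for inverses of
  evaluated words.\<close>

lemma Gam_adj: "g \<in> Gam \<Longrightarrow> g * adj g = 1 \<Longrightarrow> adj g \<in> Gam"
  by (metis Gam_inverse mult.assoc mult_1_left mult_1_right)

lemmas Gam_adjI = Gam_adj [unfolded one_mat5_def]

lemmas g0 = gA_in [unfolded gA_def] and g1 = gC_in [unfolded gC_def]

text \<open>Evaluated words in the generators: the matrix in each fact is computed by the simplifier from
  the preceding ones. Only the facts collected in \<open>cert\<close> matter afterwards.\<close>

lemmas g2 = Gam_mult [OF g0 g0, simplified]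
lemmas g3 = Gam_mult [OF g0 g2, simplified]
lemmas g4 = Gam_mult [OF g0 g3, simplified]
lemmas g5 = Gam_mult [OF g0 g4, simplified]
lemmas g6 = Gam_mult [OF g0 g5, simplified]
lemmas g7 = Gam_mult [OF g0 g6, simplified]
lemmas g8 = Gam_mult [OF g0 g7, simplified]
lemmas g9 = Gam_mult [OF g0 g8, simplified]
lemmas g10 = Gam_mult [OF g0 g9, simplified]
lemmas g11 = Gam_mult [OF g0 g10, simplified]
lemmas g12 = Gam_mult [OF g2 g1, simplified]
lemmas g13 = Gam_mult [OF g8 g1, simplified]
lemmas g14 = Gam_mult [OF g13 g5, simplified]
lemmas g15 = Gam_mult [OF g14 g6, simplified]
lemmas g16 = Gam_mult [OF g14 g8, simplified]
lemmas g17 = Gam_mult [OF g11 g15, simplified]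
lemmas g18 = Gam_mult [OF g5 g15, simplified]
lemmas g19 = Gam_mult [OF g1 g18, simplified]
lemmas g20 = Gam_mult [OF g19 g12, simplified]
lemmas g21 = Gam_mult [OF g11 g20, simplified]
lemmas g22 = Gam_mult [OF g20 g18, simplified]
lemmas g23 = Gam_adjI [OF g20, simplified]
lemmas g24 = Gam_mult [OF g21 g0, simplified]
lemmas g25 = Gam_mult [OF g1 g22, simplified]
lemmas g26 = Gam_mult [OF g22 g23, simplified]
lemmas g27 = Gam_mult [OF g25 g6, simplified]
lemmas g28 = Gam_mult [OF g25 g7, simplified]
lemmas g29 = Gam_mult [OF g25 g11, simplified]
lemmas g30 = Gam_mult [OF g12 g27, simplified]
lemmas g31 = Gam_mult [OF g6 g28, simplified]
lemmas g32 = Gam_adjI [OF g29, simplified]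
lemmas g33 = Gam_mult [OF g31 g31, simplified]
lemmas g34 = Gam_mult [OF g31 g13, simplified]
lemmas g35 = Gam_mult [OF g33 g10, simplified]
lemmas g36 = Gam_mult [OF g34 g2, simplified]
lemmas g37 = Gam_adjI [OF g35, simplified]
lemmas g38 = Gam_mult [OF g36 g20, simplified]
lemmas g39 = Gam_mult [OF g36 g24, simplified]
lemmas g40 = Gam_mult [OF g37 g31, simplified]
lemmas g41 = Gam_mult [OF g40 g4, simplified]
lemmas g42 = Gam_mult [OF g40 g35, simplified]
lemmas g43 = Gam_mult [OF g41 g30, simplified]
lemmas g44 = Gam_mult [OF g28 g42, simplified]
lemmas g45 = Gam_mult [OF g43 g2, simplified]
lemmas g46 = Gam_mult [OF g44 g45, simplified]
lemmas g47 = Gam_adjI [OF g45, simplified]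
lemmas g48 = Gam_mult [OF g4 g47, simplified]
lemmas g49 = Gam_mult [OF g48 g7, simplified]
lemmas g50 = Gam_adjI [OF g49, simplified]
lemmas g51 = Gam_mult [OF g0 g50, simplified]
lemmas g52 = Gam_mult [OF g26 g51, simplified]
lemmas g53 = Gam_mult [OF g6 g52, simplified]
lemmas g54 = Gam_mult [OF g10 g52, simplified]
lemmas g55 = Gam_mult [OF g52 g0, simplified]
lemmas g56 = Gam_mult [OF g52 g3, simplified]
lemmas g57 = Gam_mult [OF g52 g6, simplified]
lemmas g58 = Gam_mult [OF g48 g53, simplified]
lemmas g59 = Gam_mult [OF g53 g7, simplified]
lemmas g60 = Gam_mult [OF g53 g9, simplified]
lemmas g61 = Gam_mult [OF g54 g4, simplified]
lemmas g62 = Gam_mult [OF g59 g55, simplified]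
lemmas g63 = Gam_adjI [OF g55, simplified]
lemmas g64 = Gam_adjI [OF g56, simplified]
lemmas g65 = Gam_mult [OF g6 g58, simplified]
lemmas g66 = Gam_mult [OF g58 g6, simplified]
lemmas g67 = Gam_adjI [OF g59, simplified]
lemmas g68 = Gam_mult [OF g9 g60, simplified]
lemmas g69 = Gam_mult [OF g48 g62, simplified]
lemmas g70 = Gam_mult [OF g3 g63, simplified]
lemmas g71 = Gam_mult [OF g6 g63, simplified]
lemmas g72 = Gam_mult [OF g63 g2, simplified]
lemmas g73 = Gam_mult [OF g63 g3, simplified]
lemmas g74 = Gam_mult [OF g63 g10, simplified]
lemmas g75 = Gam_mult [OF g67 g4, simplified]
lemmas g76 = Gam_mult [OF g67 g11, simplified]
lemmas g77 = Gam_mult [OF g67 g72, simplified]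
lemmas g78 = Gam_mult [OF g17 g67, simplified]
lemmas g79 = Gam_mult [OF g68 g0, simplified]
lemmas g80 = Gam_mult [OF g11 g69, simplified]
lemmas g81 = Gam_mult [OF g76 g69, simplified]
lemmas g82 = Gam_mult [OF g70 g0, simplified]
lemmas g83 = Gam_mult [OF g70 g26, simplified]
lemmas g84 = Gam_mult [OF g18 g71, simplified]
lemmas g85 = Gam_mult [OF g26 g71, simplified]
lemmas g86 = Gam_mult [OF g85 g77, simplified]
lemmas g87 = Gam_mult [OF g2 g79, simplified]
lemmas g88 = Gam_mult [OF g79 g55, simplified]
lemmas g89 = Gam_mult [OF g80 g62, simplified]
lemmas g90 = Gam_mult [OF g81 g63, simplified]
lemmas g91 = Gam_mult [OF g81 g59, simplified]
lemmas g92 = Gam_mult [OF g8 g83, simplified]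
lemmas g93 = Gam_mult [OF g86 g10, simplified]
lemmas g94 = Gam_mult [OF g4 g88, simplified]
lemmas g95 = Gam_mult [OF g6 g88, simplified]
lemmas g96 = Gam_mult [OF g88 g88, simplified]
lemmas g97 = Gam_mult [OF g94 g88, simplified]
lemmas g98 = Gam_adjI [OF g88, simplified]
lemmas g99 = Gam_mult [OF g89 g62, simplified]
lemmas g100 = Gam_mult [OF g92 g19, simplified]
lemmas g101 = Gam_mult [OF g94 g42, simplified]
lemmas g102 = Gam_mult [OF g95 g8, simplified]
lemmas g103 = Gam_mult [OF g64 g95, simplified]
lemmas g104 = Gam_adjI [OF g97, simplified]
lemmas g105 = Gam_mult [OF g6 g98, simplified]
lemmas g106 = Gam_mult [OF g10 g98, simplified]
lemmas g107 = Gam_mult [OF g88 g99, simplified]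
lemmas g108 = Gam_mult [OF g99 g59, simplified]
lemmas g109 = Gam_mult [OF g100 g26, simplified]
lemmas g110 = Gam_mult [OF g101 g11, simplified]
lemmas g111 = Gam_adjI [OF g102, simplified]
lemmas g112 = Gam_mult [OF g103 g11, simplified]
lemmas g113 = Gam_mult [OF g4 g104, simplified]
lemmas g114 = Gam_mult [OF g6 g104, simplified]
lemmas g115 = Gam_mult [OF g105 g104, simplified]
lemmas g116 = Gam_mult [OF g105 g2, simplified]
lemmas g117 = Gam_mult [OF g106 g8, simplified]
lemmas g118 = Gam_mult [OF g106 g115, simplified]
lemmas g119 = Gam_mult [OF g107 g98, simplified]
lemmas g120 = Gam_mult [OF g55 g108, simplified]
lemmas g121 = Gam_adjI [OF g109, simplified]
lemmas g122 = Gam_mult [OF g10 g111, simplified]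
lemmas g123 = Gam_mult [OF g11 g111, simplified]
lemmas g124 = Gam_mult [OF g111 g8, simplified]
lemmas g125 = Gam_mult [OF g112 g40, simplified]
lemmas g126 = Gam_mult [OF g124 g116, simplified]
lemmas g127 = Gam_mult [OF g87 g116, simplified]
lemmas g128 = Gam_mult [OF g97 g116, simplified]
lemmas g129 = Gam_adjI [OF g116, simplified]
lemmas g130 = Gam_mult [OF g117 g98, simplified]
lemmas g131 = Gam_mult [OF g33 g118, simplified]
lemmas g132 = Gam_mult [OF g118 g35, simplified]
lemmas g133 = Gam_mult [OF g1 g121, simplified]
lemmas g134 = Gam_mult [OF g100 g121, simplified]
lemmas g135 = Gam_mult [OF g32 g124, simplified]
lemmas g136 = Gam_mult [OF g4 g126, simplified]
lemmas g137 = Gam_mult [OF g10 g126, simplified]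
lemmas g138 = Gam_mult [OF g130 g128, simplified]
lemmas g139 = Gam_mult [OF g129 g128, simplified]
lemmas g140 = Gam_mult [OF g129 g82, simplified]
lemmas g141 = Gam_mult [OF g114 g131, simplified]
lemmas g142 = Gam_mult [OF g131 g3, simplified]
lemmas g143 = Gam_mult [OF g131 g9, simplified]
lemmas g144 = Gam_adjI [OF g131, simplified]
lemmas g145 = Gam_mult [OF g2 g132, simplified]
lemmas g146 = Gam_mult [OF g4 g132, simplified]
lemmas g147 = Gam_mult [OF g8 g132, simplified]
lemmas g148 = Gam_mult [OF g9 g132, simplified]
lemmas g149 = Gam_mult [OF g10 g132, simplified]
lemmas g150 = Gam_mult [OF g132 g104, simplified]
lemmas g151 = Gam_mult [OF g132 g115, simplified]
lemmas g152 = Gam_adjI [OF g132, simplified]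
lemmas g153 = Gam_mult [OF g109 g133, simplified]
lemmas g154 = Gam_mult [OF g0 g135, simplified]
lemmas g155 = Gam_mult [OF g137 g136, simplified]
lemmas g156 = Gam_mult [OF g137 g150, simplified]
lemmas g157 = Gam_mult [OF g138 g144, simplified]
lemmas g158 = Gam_mult [OF g141 g3, simplified]
lemmas g159 = Gam_mult [OF g141 g7, simplified]
lemmas g160 = Gam_mult [OF g141 g106, simplified]
lemmas g161 = Gam_mult [OF g106 g141, simplified]
lemmas g162 = Gam_mult [OF g117 g141, simplified]
lemmas g163 = Gam_adjI [OF g142, simplified]
lemmas g164 = Gam_adjI [OF g143, simplified]
lemmas g165 = Gam_mult [OF g4 g144, simplified]
lemmas g166 = Gam_mult [OF g6 g144, simplified]
lemmas g167 = Gam_mult [OF g11 g144, simplified]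
lemmas g168 = Gam_mult [OF g144 g4, simplified]
lemmas g169 = Gam_mult [OF g144 g8, simplified]
lemmas g170 = Gam_mult [OF g104 g144, simplified]
lemmas g171 = Gam_adjI [OF g146, simplified]
lemmas g172 = Gam_mult [OF g152 g148, simplified]
lemmas g173 = Gam_mult [OF g149 g97, simplified]
lemmas g174 = Gam_mult [OF g106 g150, simplified]
lemmas g175 = Gam_mult [OF g151 g172, simplified]
lemmas g176 = Gam_adjI [OF g151, simplified]
lemmas g177 = Gam_mult [OF g152 g5, simplified]
lemmas g178 = Gam_mult [OF g176 g155, simplified]
lemmas g179 = Gam_mult [OF g10 g156, simplified]
lemmas g180 = Gam_mult [OF g156 g4, simplified]
lemmas g181 = Gam_mult [OF g160 g117, simplified]
lemmas g182 = Gam_adjI [OF g161, simplified]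
lemmas g183 = Gam_mult [OF g105 g162, simplified]
lemmas g184 = Gam_mult [OF g163 g3, simplified]
lemmas g185 = Gam_mult [OF g163 g46, simplified]
lemmas g186 = Gam_mult [OF g165 g97, simplified]
lemmas g187 = Gam_mult [OF g170 g166, simplified]
lemmas g188 = Gam_mult [OF g118 g166, simplified]
lemmas g189 = Gam_mult [OF g167 g0, simplified]
lemmas g190 = Gam_mult [OF g64 g170, simplified]
lemmas g191 = Gam_mult [OF g170 g64, simplified]
lemmas g192 = Gam_mult [OF g3 g172, simplified]
lemmas g193 = Gam_mult [OF g123 g172, simplified]
lemmas g194 = Gam_mult [OF g5 g174, simplified]
lemmas g195 = Gam_mult [OF g174 g179, simplified]
lemmas g196 = Gam_mult [OF g88 g176, simplified]
lemmas g197 = Gam_mult [OF g176 g134, simplified]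
lemmas g198 = Gam_mult [OF g144 g178, simplified]
lemmas g199 = Gam_mult [OF g102 g180, simplified]
lemmas g200 = Gam_mult [OF g181 g158, simplified]
lemmas g201 = Gam_mult [OF g155 g182, simplified]
lemmas g202 = Gam_mult [OF g134 g182, simplified]
lemmas g203 = Gam_mult [OF g182 g88, simplified]
lemmas g204 = Gam_mult [OF g182 g186, simplified]
lemmas g205 = Gam_mult [OF g146 g183, simplified]
lemmas g206 = Gam_mult [OF g0 g186, simplified]
lemmas g207 = Gam_mult [OF g3 g186, simplified]
lemmas g208 = Gam_mult [OF g4 g186, simplified]
lemmas g209 = Gam_mult [OF g40 g188, simplified]
lemmas g210 = Gam_mult [OF g190 g144, simplified]
lemmas g211 = Gam_mult [OF g105 g191, simplified]
lemmas g212 = Gam_mult [OF g150 g196, simplified]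
lemmas g213 = Gam_mult [OF g6 g197, simplified]
lemmas g214 = Gam_mult [OF g197 g6, simplified]
lemmas g215 = Gam_mult [OF g10 g199, simplified]
lemmas g216 = Gam_mult [OF g148 g200, simplified]
lemmas g217 = Gam_mult [OF g6 g202, simplified]
lemmas g218 = Gam_mult [OF g202 g6, simplified]
lemmas g219 = Gam_mult [OF g203 g6, simplified]
lemmas g220 = Gam_mult [OF g203 g10, simplified]
lemmas g221 = Gam_mult [OF g207 g203, simplified]
lemmas g222 = Gam_mult [OF g205 g141, simplified]
lemmas g223 = Gam_mult [OF g206 g175, simplified]
lemmas g224 = Gam_mult [OF g208 g179, simplified]
lemmas g225 = Gam_mult [OF g111 g209, simplified]
lemmas g226 = Gam_mult [OF g210 g164, simplified]
lemmas g227 = Gam_mult [OF g131 g210, simplified]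
lemmas g228 = Gam_mult [OF g211 g25, simplified]
lemmas g229 = Gam_mult [OF g167 g219, simplified]
lemmas g230 = Gam_mult [OF g221 g177, simplified]
lemmas g231 = Gam_mult [OF g204 g224, simplified]
lemmas g232 = Gam_mult [OF g225 g6, simplified]
lemmas g233 = Gam_mult [OF g72 g226, simplified]
lemmas g234 = Gam_mult [OF g54 g226, simplified]
lemmas g235 = Gam_mult [OF g227 g2, simplified]
lemmas g236 = Gam_mult [OF g168 g228, simplified]
lemmas g237 = Gam_mult [OF g230 g6, simplified]
lemmas g238 = Gam_mult [OF g231 g156, simplified]
lemmas g239 = Gam_mult [OF g231 g203, simplified]
lemmas g240 = Gam_mult [OF g0 g233, simplified]
lemmas g241 = Gam_mult [OF g3 g233, simplified]
lemmas g242 = Gam_mult [OF g7 g233, simplified]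
lemmas g243 = Gam_mult [OF g8 g233, simplified]
lemmas g244 = Gam_mult [OF g10 g233, simplified]
lemmas g245 = Gam_mult [OF g11 g233, simplified]
lemmas g246 = Gam_mult [OF g233 g146, simplified]
lemmas g247 = Gam_mult [OF g168 g233, simplified]
lemmas g248 = Gam_mult [OF g75 g233, simplified]
lemmas g249 = Gam_mult [OF g6 g237, simplified]
lemmas g250 = Gam_mult [OF g144 g238, simplified]
lemmas g251 = Gam_mult [OF g238 g244, simplified]
lemmas g252 = Gam_mult [OF g114 g239, simplified]
lemmas g253 = Gam_adjI [OF g239, simplified]
lemmas g254 = Gam_mult [OF g184 g240, simplified]
lemmas g255 = Gam_mult [OF g189 g240, simplified]
lemmas g256 = Gam_mult [OF g240 g248, simplified]
lemmas g257 = Gam_mult [OF g189 g241, simplified]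
lemmas g258 = Gam_mult [OF g200 g242, simplified]
lemmas g259 = Gam_mult [OF g186 g243, simplified]
lemmas g260 = Gam_mult [OF g243 g55, simplified]
lemmas g261 = Gam_mult [OF g243 g186, simplified]
lemmas g262 = Gam_mult [OF g243 g141, simplified]
lemmas g263 = Gam_mult [OF g244 g142, simplified]
lemmas g264 = Gam_mult [OF g244 g131, simplified]
lemmas g265 = Gam_mult [OF g244 g134, simplified]
lemmas g266 = Gam_mult [OF g244 g150, simplified]
lemmas g267 = Gam_mult [OF g244 g251, simplified]
lemmas g268 = Gam_mult [OF g260 g244, simplified]
lemmas g269 = Gam_mult [OF g167 g244, simplified]
lemmas g270 = Gam_mult [OF g265 g244, simplified]
lemmas g271 = Gam_mult [OF g142 g245, simplified]
lemmas g272 = Gam_mult [OF g245 g39, simplified]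
lemmas g273 = Gam_mult [OF g152 g246, simplified]
lemmas g274 = Gam_mult [OF g164 g246, simplified]
lemmas g275 = Gam_mult [OF g167 g246, simplified]
lemmas g276 = Gam_mult [OF g246 g2, simplified]
lemmas g277 = Gam_mult [OF g246 g3, simplified]
lemmas g278 = Gam_mult [OF g246 g167, simplified]
lemmas g279 = Gam_mult [OF g246 g258, simplified]
lemmas g280 = Gam_mult [OF g142 g247, simplified]
lemmas g281 = Gam_mult [OF g161 g247, simplified]
lemmas g282 = Gam_mult [OF g248 g73, simplified]
lemmas g283 = Gam_adjI [OF g251, simplified]
lemmas g284 = Gam_mult [OF g252 g171, simplified]
lemmas g285 = Gam_mult [OF g71 g255, simplified]
lemmas g286 = Gam_mult [OF g255 g147, simplified]
lemmas g287 = Gam_mult [OF g3 g256, simplified]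
lemmas g288 = Gam_mult [OF g256 g14, simplified]
lemmas g289 = Gam_mult [OF g285 g257, simplified]
lemmas g290 = Gam_mult [OF g12 g257, simplified]
lemmas g291 = Gam_mult [OF g171 g259, simplified]
lemmas g292 = Gam_mult [OF g68 g260, simplified]
lemmas g293 = Gam_mult [OF g260 g147, simplified]
lemmas g294 = Gam_mult [OF g261 g219, simplified]
lemmas g295 = Gam_mult [OF g262 g232, simplified]
lemmas g296 = Gam_mult [OF g263 g168, simplified]
lemmas g297 = Gam_mult [OF g263 g169, simplified]
lemmas g298 = Gam_mult [OF g144 g264, simplified]
lemmas g299 = Gam_mult [OF g266 g172, simplified]
lemmas g300 = Gam_mult [OF g266 g225, simplified]
lemmas g301 = Gam_mult [OF g267 g6, simplified]
lemmas g302 = Gam_mult [OF g268 g116, simplified]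
lemmas g303 = Gam_mult [OF g268 g12, simplified]
lemmas g304 = Gam_mult [OF g285 g269, simplified]
lemmas g305 = Gam_mult [OF g6 g270, simplified]
lemmas g306 = Gam_mult [OF g270 g6, simplified]
lemmas g307 = Gam_mult [OF g207 g271, simplified]
lemmas g308 = Gam_mult [OF g274 g169, simplified]
lemmas g309 = Gam_mult [OF g280 g275, simplified]
lemmas g310 = Gam_mult [OF g275 g96, simplified]
lemmas g311 = Gam_mult [OF g210 g277, simplified]
lemmas g312 = Gam_mult [OF g170 g277, simplified]
lemmas g313 = Gam_mult [OF g277 g170, simplified]
lemmas g314 = Gam_mult [OF g277 g56, simplified]
lemmas g315 = Gam_mult [OF g278 g191, simplified]
lemmas g316 = Gam_mult [OF g49 g278, simplified]
lemmas g317 = Gam_mult [OF g169 g281, simplified]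
lemmas g318 = Gam_mult [OF g282 g193, simplified]
lemmas g319 = Gam_mult [OF g283 g244, simplified]
lemmas g320 = Gam_mult [OF g239 g284, simplified]
lemmas g321 = Gam_mult [OF g125 g286, simplified]
lemmas g322 = Gam_mult [OF g287 g13, simplified]
lemmas g323 = Gam_mult [OF g187 g288, simplified]
lemmas g324 = Gam_mult [OF g10 g289, simplified]
lemmas g325 = Gam_adjI [OF g290, simplified]
lemmas g326 = Gam_mult [OF g229 g291, simplified]
lemmas g327 = Gam_mult [OF g292 g318, simplified]
lemmas g328 = Gam_mult [OF g294 g11, simplified]
lemmas g329 = Gam_mult [OF g296 g227, simplified]
lemmas g330 = Gam_mult [OF g304 g296, simplified]
lemmas g331 = Gam_mult [OF g297 g227, simplified]
lemmas g332 = Gam_mult [OF g38 g298, simplified]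
lemmas g333 = Gam_mult [OF g299 g144, simplified]
lemmas g334 = Gam_mult [OF g299 g320, simplified]
lemmas g335 = Gam_mult [OF g302 g64, simplified]
lemmas g336 = Gam_mult [OF g302 g311, simplified]
lemmas g337 = Gam_mult [OF g302 g243, simplified]
lemmas g338 = Gam_mult [OF g302 g317, simplified]
lemmas g339 = Gam_mult [OF g2 g304, simplified]
lemmas g340 = Gam_mult [OF g8 g304, simplified]
lemmas g341 = Gam_mult [OF g55 g304, simplified]
lemmas g342 = Gam_mult [OF g255 g304, simplified]
lemmas g343 = Gam_mult [OF g236 g310, simplified]
lemmas g344 = Gam_mult [OF g310 g253, simplified]
lemmas g345 = Gam_mult [OF g11 g311, simplified]
lemmas g346 = Gam_mult [OF g311 g329, simplified]
lemmas g347 = Gam_mult [OF g312 g3, simplified]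
lemmas g348 = Gam_mult [OF g312 g78, simplified]
lemmas g349 = Gam_mult [OF g312 g84, simplified]
lemmas g350 = Gam_mult [OF g313 g320, simplified]
lemmas g351 = Gam_mult [OF g234 g313, simplified]
lemmas g352 = Gam_mult [OF g131 g314, simplified]
lemmas g353 = Gam_mult [OF g227 g314, simplified]
lemmas g354 = Gam_mult [OF g18 g315, simplified]
lemmas g355 = Gam_mult [OF g329 g315, simplified]
lemmas g356 = Gam_mult [OF g315 g329, simplified]
lemmas g357 = Gam_mult [OF g78 g318, simplified]
lemmas g358 = Gam_mult [OF g113 g320, simplified]
lemmas g359 = Gam_mult [OF g320 g138, simplified]
lemmas g360 = Gam_mult [OF g320 g110, simplified]
lemmas g361 = Gam_mult [OF g157 g320, simplified]
lemmas g362 = Gam_mult [OF g275 g320, simplified]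
lemmas g363 = Gam_adjI [OF g320, simplified]
lemmas g364 = Gam_mult [OF g322 g6, simplified]
lemmas g365 = Gam_mult [OF g269 g324, simplified]
lemmas g366 = Gam_mult [OF g12 g324, simplified]
lemmas g367 = Gam_mult [OF g325 g331, simplified]
lemmas g368 = Gam_mult [OF g326 g6, simplified]
lemmas g369 = Gam_mult [OF g10 g328, simplified]
lemmas g370 = Gam_mult [OF g58 g329, simplified]
lemmas g371 = Gam_mult [OF g329 g3, simplified]
lemmas g372 = Gam_mult [OF g329 g6, simplified]
lemmas g373 = Gam_mult [OF g331 g277, simplified]
lemmas g374 = Gam_mult [OF g144 g332, simplified]
lemmas g375 = Gam_mult [OF g86 g335, simplified]
lemmas g376 = Gam_mult [OF g336 g86, simplified]
lemmas g377 = Gam_mult [OF g337 g76, simplified]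
lemmas g378 = Gam_mult [OF g272 g338, simplified]
lemmas g379 = Gam_mult [OF g340 g365, simplified]
lemmas g380 = Gam_mult [OF g285 g341, simplified]
lemmas g381 = Gam_mult [OF g341 g8, simplified]
lemmas g382 = Gam_mult [OF g17 g341, simplified]
lemmas g383 = Gam_mult [OF g4 g342, simplified]
lemmas g384 = Gam_mult [OF g342 g355, simplified]
lemmas g385 = Gam_mult [OF g343 g6, simplified]
lemmas g386 = Gam_mult [OF g344 g263, simplified]
lemmas g387 = Gam_mult [OF g345 g84, simplified]
lemmas g388 = Gam_mult [OF g0 g346, simplified]
lemmas g389 = Gam_mult [OF g346 g290, simplified]
lemmas g390 = Gam_mult [OF g348 g184, simplified]
lemmas g391 = Gam_mult [OF g349 g184, simplified]
lemmas g392 = Gam_mult [OF g350 g254, simplified]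
lemmas g393 = Gam_mult [OF g296 g352, simplified]
lemmas g394 = Gam_mult [OF g354 g75, simplified]
lemmas g395 = Gam_mult [OF g356 g354, simplified]
lemmas g396 = Gam_mult [OF g356 g289, simplified]
lemmas g397 = Gam_mult [OF g361 g179, simplified]
lemmas g398 = Gam_mult [OF g295 g362, simplified]
lemmas g399 = Gam_mult [OF g300 g362, simplified]
lemmas g400 = Gam_mult [OF g362 g369, simplified]
lemmas g401 = Gam_adjI [OF g362, simplified]
lemmas g402 = Gam_mult [OF g154 g363, simplified]
lemmas g403 = Gam_mult [OF g372 g364, simplified]
lemmas g404 = Gam_mult [OF g365 g289, simplified]
lemmas g405 = Gam_mult [OF g366 g304, simplified]
lemmas g406 = Gam_mult [OF g367 g2, simplified]
lemmas g407 = Gam_mult [OF g6 g368, simplified]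
lemmas g408 = Gam_mult [OF g369 g254, simplified]
lemmas g409 = Gam_mult [OF g370 g8, simplified]
lemmas g410 = Gam_adjI [OF g370, simplified]
lemmas g411 = Gam_mult [OF g65 g371, simplified]
lemmas g412 = Gam_mult [OF g375 g122, simplified]
lemmas g413 = Gam_mult [OF g378 g264, simplified]
lemmas g414 = Gam_mult [OF g339 g380, simplified]
lemmas g415 = Gam_mult [OF g15 g381, simplified]
lemmas g416 = Gam_mult [OF g382 g166, simplified]
lemmas g417 = Gam_mult [OF g383 g277, simplified]
lemmas g418 = Gam_mult [OF g384 g310, simplified]
lemmas g419 = Gam_mult [OF g6 g385, simplified]
lemmas g420 = Gam_mult [OF g387 g241, simplified]
lemmas g421 = Gam_mult [OF g303 g388, simplified]
lemmas g422 = Gam_mult [OF g273 g388, simplified]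
lemmas g423 = Gam_adjI [OF g392, simplified]
lemmas g424 = Gam_mult [OF g393 g322, simplified]
lemmas g425 = Gam_mult [OF g393 g316, simplified]
lemmas g426 = Gam_adjI [OF g393, simplified]
lemmas g427 = Gam_mult [OF g4 g394, simplified]
lemmas g428 = Gam_mult [OF g394 g140, simplified]
lemmas g429 = Gam_mult [OF g395 g297, simplified]
lemmas g430 = Gam_mult [OF g185 g396, simplified]
lemmas g431 = Gam_mult [OF g397 g6, simplified]
lemmas g432 = Gam_mult [OF g397 g16, simplified]
lemmas g433 = Gam_mult [OF g13 g397, simplified]
lemmas g434 = Gam_mult [OF g401 g216, simplified]
lemmas g435 = Gam_mult [OF g401 g240, simplified]
lemmas g436 = Gam_mult [OF g308 g401, simplified]
lemmas g437 = Gam_mult [OF g404 g2, simplified]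
lemmas g438 = Gam_mult [OF g235 g405, simplified]
lemmas g439 = Gam_mult [OF g6 g406, simplified]
lemmas g440 = Gam_mult [OF g311 g410, simplified]
lemmas g441 = Gam_mult [OF g411 g11, simplified]
lemmas g442 = Gam_mult [OF g194 g412, simplified]
lemmas g443 = Gam_adjI [OF g413, simplified]
lemmas g444 = Gam_mult [OF g414 g423, simplified]
lemmas g445 = Gam_mult [OF g414 g362, simplified]
lemmas g446 = Gam_mult [OF g415 g165, simplified]
lemmas g447 = Gam_mult [OF g132 g416, simplified]
lemmas g448 = Gam_mult [OF g417 g49, simplified]
lemmas g449 = Gam_mult [OF g417 g17, simplified]
lemmas g450 = Gam_mult [OF g376 g417, simplified]
lemmas g451 = Gam_mult [OF g419 g309, simplified]
lemmas g452 = Gam_mult [OF g243 g420, simplified]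
lemmas g453 = Gam_mult [OF g347 g421, simplified]
lemmas g454 = Gam_mult [OF g421 g57, simplified]
lemmas g455 = Gam_mult [OF g145 g422, simplified]
lemmas g456 = Gam_mult [OF g422 g330, simplified]
lemmas g457 = Gam_mult [OF g423 g254, simplified]
lemmas g458 = Gam_mult [OF g50 g426, simplified]
lemmas g459 = Gam_mult [OF g426 g289, simplified]
lemmas g460 = Gam_mult [OF g427 g139, simplified]
lemmas g461 = Gam_mult [OF g427 g220, simplified]
lemmas g462 = Gam_mult [OF g280 g429, simplified]
lemmas g463 = Gam_mult [OF g430 g6, simplified]
lemmas g464 = Gam_mult [OF g12 g431, simplified]
lemmas g465 = Gam_mult [OF g246 g432, simplified]
lemmas g466 = Gam_mult [OF g432 g123, simplified]
lemmas g467 = Gam_mult [OF g342 g433, simplified]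
lemmas g468 = Gam_mult [OF g255 g436, simplified]
lemmas g469 = Gam_adjI [OF g437, simplified]
lemmas g470 = Gam_mult [OF g438 g6, simplified]
lemmas g471 = Gam_mult [OF g440 g383, simplified]
lemmas g472 = Gam_mult [OF g442 g0, simplified]
lemmas g473 = Gam_mult [OF g442 g7, simplified]
lemmas g474 = Gam_mult [OF g276 g443, simplified]
lemmas g475 = Gam_mult [OF g444 g254, simplified]
lemmas g476 = Gam_mult [OF g142 g446, simplified]
lemmas g477 = Gam_mult [OF g448 g373, simplified]
lemmas g478 = Gam_mult [OF g152 g449, simplified]
lemmas g479 = Gam_mult [OF g60 g450, simplified]
lemmas g480 = Gam_mult [OF g396 g451, simplified]
lemmas g481 = Gam_mult [OF g454 g244, simplified]
lemmas g482 = Gam_mult [OF g71 g455, simplified]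
lemmas g483 = Gam_mult [OF g456 g191, simplified]
lemmas g484 = Gam_mult [OF g456 g227, simplified]
lemmas g485 = Gam_mult [OF g379 g457, simplified]
lemmas g486 = Gam_mult [OF g280 g458, simplified]
lemmas g487 = Gam_mult [OF g465 g459, simplified]
lemmas g488 = Gam_mult [OF g459 g254, simplified]
lemmas g489 = Gam_mult [OF g130 g460, simplified]
lemmas g490 = Gam_mult [OF g61 g461, simplified]
lemmas g491 = Gam_mult [OF g215 g461, simplified]
lemmas g492 = Gam_mult [OF g461 g293, simplified]
lemmas g493 = Gam_mult [OF g461 g199, simplified]
lemmas g494 = Gam_mult [OF g6 g462, simplified]
lemmas g495 = Gam_mult [OF g462 g6, simplified]
lemmas g496 = Gam_mult [OF g6 g463, simplified]
lemmas g497 = Gam_adjI [OF g465, simplified]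
lemmas g498 = Gam_mult [OF g102 g466, simplified]
lemmas g499 = Gam_mult [OF g467 g296, simplified]
lemmas g500 = Gam_mult [OF g468 g263, simplified]
lemmas g501 = Gam_mult [OF g312 g469, simplified]
lemmas g502 = Gam_mult [OF g6 g470, simplified]
lemmas g503 = Gam_mult [OF g471 g6, simplified]
lemmas g504 = Gam_mult [OF g6 g473, simplified]
lemmas g505 = Gam_mult [OF g474 g6, simplified]
lemmas g506 = Gam_mult [OF g475 g320, simplified]
lemmas g507 = Gam_mult [OF g477 g6, simplified]
lemmas g508 = Gam_mult [OF g479 g63, simplified]
lemmas g509 = Gam_mult [OF g62 g479, simplified]
lemmas g510 = Gam_mult [OF g480 g6, simplified]
lemmas g511 = Gam_mult [OF g243 g481, simplified]
lemmas g512 = Gam_mult [OF g323 g482, simplified]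
lemmas g513 = Gam_mult [OF g485 g320, simplified]
lemmas g514 = Gam_mult [OF g486 g6, simplified]
lemmas g515 = Gam_mult [OF g488 g321, simplified]
lemmas g516 = Gam_mult [OF g83 g490, simplified]
lemmas g517 = Gam_mult [OF g6 g491, simplified]
lemmas g518 = Gam_mult [OF g195 g491, simplified]
lemmas g519 = Gam_mult [OF g233 g492, simplified]
lemmas g520 = Gam_mult [OF g493 g62, simplified]
lemmas g521 = Gam_mult [OF g417 g497, simplified]
lemmas g522 = Gam_mult [OF g500 g350, simplified]
lemmas g523 = Gam_mult [OF g6 g503, simplified]
lemmas g524 = Gam_mult [OF g6 g507, simplified]
lemmas g525 = Gam_mult [OF g55 g508, simplified]
lemmas g526 = Gam_mult [OF g67 g508, simplified]
lemmas g527 = Gam_mult [OF g6 g510, simplified]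
lemmas g528 = Gam_mult [OF g515 g6, simplified]
lemmas g529 = Gam_adjI [OF g516, simplified]
lemmas g530 = Gam_mult [OF g517 g4, simplified]
lemmas g531 = Gam_mult [OF g517 g212, simplified]
lemmas g532 = Gam_mult [OF g518 g95, simplified]
lemmas g533 = Gam_mult [OF g520 g62, simplified]
lemmas g534 = Gam_mult [OF g4 g521, simplified]
lemmas g535 = Gam_mult [OF g521 g367, simplified]
lemmas g536 = Gam_mult [OF g6 g528, simplified]
lemmas g537 = Gam_mult [OF g529 g66, simplified]
lemmas g538 = Gam_mult [OF g127 g530, simplified]
lemmas g539 = Gam_mult [OF g74 g530, simplified]
lemmas g540 = Gam_mult [OF g126 g531, simplified]
lemmas g541 = Gam_mult [OF g532 g159, simplified]
lemmas g542 = Gam_mult [OF g534 g6, simplified]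
lemmas g543 = Gam_adjI [OF g535, simplified]
lemmas g544 = Gam_mult [OF g537 g247, simplified]
lemmas g545 = Gam_mult [OF g539 g53, simplified]
lemmas g546 = Gam_mult [OF g539 g318, simplified]
lemmas g547 = Gam_mult [OF g117 g541, simplified]
lemmas g548 = Gam_mult [OF g417 g543, simplified]
lemmas g549 = Gam_mult [OF g246 g544, simplified]
lemmas g550 = Gam_mult [OF g545 g143, simplified]
lemmas g551 = Gam_mult [OF g3 g547, simplified]
lemmas g552 = Gam_mult [OF g9 g547, simplified]
lemmas g553 = Gam_mult [OF g548 g269, simplified]
lemmas g554 = Gam_mult [OF g549 g6, simplified]
lemmas g555 = Gam_mult [OF g0 g550, simplified]
lemmas g556 = Gam_mult [OF g552 g6, simplified]
lemmas g557 = Gam_mult [OF g396 g553, simplified]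
lemmas g558 = Gam_mult [OF g553 g396, simplified]
lemmas g559 = Gam_mult [OF g6 g554, simplified]
lemmas g560 = Gam_mult [OF g164 g555, simplified]
lemmas g561 = Gam_mult [OF g557 g263, simplified]
lemmas g562 = Gam_mult [OF g558 g263, simplified]
lemmas g563 = Gam_mult [OF g560 g6, simplified]
lemmas g564 = Gam_mult [OF g6 g563, simplified]

lemmas cert =
  g78 g80 g84 g85 g89 g90 g91 g93 g95 g96 g99 g105 g110 g113 g117 g119 g120 g124 g138 g144 g145
  g153 g154 g157 g173 g178 g184 g189 g190 g191 g192 g193 g198 g201 g208 g210 g213 g214 g216 g217
  g218 g222 g223 g227 g230 g234 g238 g240 g249 g250 g253 g254 g255 g263 g275 g278 g279 g282 g284
  g285 g292 g295 g299 g300 g301 g305 g306 g307 g308 g312 g313 g314 g318 g319 g320 g326 g327 g330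
  g333 g334 g343 g344 g348 g349 g350 g351 g352 g353 g354 g357 g358 g359 g360 g361 g363 g369 g374
  g375 g377 g378 g379 g384 g386 g389 g390 g391 g398 g399 g400 g401 g402 g403 g407 g408 g409 g414
  g418 g419 g422 g423 g424 g425 g428 g430 g433 g434 g435 g436 g438 g439 g441 g444 g445 g447 g452
  g453 g455 g456 g457 g464 g468 g469 g471 g472 g475 g476 g477 g478 g479 g480 g483 g484 g485 g487
  g489 g493 g494 g495 g496 g498 g499 g500 g501 g502 g504 g505 g506 g509 g511 g512 g513 g514 g515
  g519 g520 g522 g523 g524 g525 g526 g527 g532 g533 g536 g538 g539 g540 g542 g546 g549 g551 g556
  g557 g558 g559 g560 g561 g562 g564

text \<open>A quotient in the coset table may be the inverse of a certified matrix, so the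
  simplifier is offered both.\<close>

lemmas cert_adj = cert [THEN Gam_adjI, simplified]

subsection \<open>The coset table\<close>

text \<open>The matrices \<open>s_x1, s_x2\<close> and \<open>s_y1, s_y2\<close> generate two commuting copies of the group \<open>\<Gamma>(2)\<close> up to
  sign, and \<open>s_s1, \<dots>, s_s4\<close> are Eichler transvections along \<open>w\<close>. The remaining five fix \<open>e\<^sub>1\<close> and \<open>f\<^sub>1\<close>;
  up to the sign of \<open>w\<close> they are symmetric squares of the matrices \<open>(3, 10; -1, -3)\<close>,
  \<open>(3, -4; -2, 3)\<close>, \<open>(3, -2; -4, 3)\<close>, \<open>(3, 4; 2, 3)\<close> and \<open>(3, 2; 4, 3)\<close>.\<close>

definition s_x1 :: mat5 where
  "s_x1 = Mat (Vec 1 0 0 0 0) (Vec 0 1 0 0 0) (Vec 0 2 1 0 0) (Vec (-2) 0 0 1 0) (Vec 0 0 0 0 1)"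

definition s_x2 :: mat5 where
  "s_x2 = Mat (Vec 1 0 0 2 0) (Vec 0 1 (-2) 0 0) (Vec 0 0 1 0 0) (Vec 0 0 0 1 0) (Vec 0 0 0 0 1)"

definition s_y1 :: mat5 where
  "s_y1 = Mat (Vec 1 0 0 0 0) (Vec (-2) 1 0 0 0) (Vec 0 0 1 2 0) (Vec 0 0 0 1 0) (Vec 0 0 0 0 1)"

definition s_y2 :: mat5 where
  "s_y2 = Mat (Vec 1 2 0 0 0) (Vec 0 1 0 0 0) (Vec 0 0 1 0 0) (Vec 0 0 (-2) 1 0) (Vec 0 0 0 0 1)"

definition s_s1 :: mat5 where
  "s_s1 = Mat (Vec 1 0 0 0 0) (Vec 0 1 0 0 0) (Vec (-18) 0 1 0 18) (Vec 0 0 0 1 0)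
      (Vec (-2) 0 0 0 1)"

definition s_s2 :: mat5 where
  "s_s2 = Mat (Vec 1 0 (-18) 0 18) (Vec 0 1 0 0 0) (Vec 0 0 1 0 0) (Vec 0 0 0 1 0)
      (Vec 0 0 (-2) 0 1)"

definition s_s3 :: mat5 where
  "s_s3 = Mat (Vec 1 0 0 0 0) (Vec 0 1 0 0 0) (Vec 0 0 1 0 0) (Vec 0 (-18) 0 1 18)
      (Vec 0 (-2) 0 0 1)"

definition s_s4 :: mat5 where
  "s_s4 = Mat (Vec 1 0 0 0 0) (Vec 0 1 0 (-18) 18) (Vec 0 0 1 0 0) (Vec 0 0 0 1 0)
      (Vec 0 0 0 (-2) 1)"

definition s_k1 :: mat5 where
  "s_k1 = Mat (Vec 1 0 0 0 0) (Vec 0 9 0 (-2) (-18)) (Vec 0 0 1 0 0) (Vec 0 (-50) 0 9 90)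
      (Vec 0 (-10) 0 2 19)"

definition s_k2 :: mat5 where
  "s_k2 = Mat (Vec 1 0 0 0 0) (Vec 0 9 0 (-8) (-36)) (Vec 0 0 1 0 0) (Vec 0 (-8) 0 9 36)
      (Vec 0 4 0 (-4) (-17))"

definition s_k3 :: mat5 where
  "s_k3 = Mat (Vec 1 0 0 0 0) (Vec 0 9 0 (-32) (-72)) (Vec 0 0 1 0 0) (Vec 0 (-2) 0 9 18)
      (Vec 0 2 0 (-8) (-17))"

definition s_k4 :: mat5 where
  "s_k4 = Mat (Vec 1 0 0 0 0) (Vec 0 9 0 (-8) 36) (Vec 0 0 1 0 0) (Vec 0 (-8) 0 9 (-36))
      (Vec 0 (-4) 0 4 (-17))"

definition s_k5 :: mat5 where
  "s_k5 = Mat (Vec 1 0 0 0 0) (Vec 0 9 0 (-32) 72) (Vec 0 0 1 0 0) (Vec 0 (-2) 0 9 (-18))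
      (Vec 0 (-2) 0 8 (-17))"

text \<open>Each representative is a word of length at most three in \<open>s_x1\<close>,
  \<open>s_x2\<close>, \<open>s_y1\<close>, \<open>s_y2\<close> and their inverses; in particular it
  fixes w and is trivial modulo 2.\<close>

definition reps :: "mat5 list" where
  "reps = [
    Mat (Vec 1 0 0 0 0) (Vec 0 1 0 0 0) (Vec 0 0 1 0 0) (Vec 0 0 0 1 0) (Vec 0 0 0 0 1),
    Mat (Vec 1 0 0 0 0) (Vec 0 1 0 0 0) (Vec 0 2 1 0 0) (Vec (-2) 0 0 1 0) (Vec 0 0 0 0 1),
    Mat (Vec 1 0 0 0 0) (Vec 0 1 0 0 0) (Vec 0 (-2) 1 0 0) (Vec 2 0 0 1 0) (Vec 0 0 0 0 1),
    Mat (Vec 1 0 0 2 0) (Vec 0 1 (-2) 0 0) (Vec 0 0 1 0 0) (Vec 0 0 0 1 0) (Vec 0 0 0 0 1),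
    Mat (Vec 1 0 0 (-2) 0) (Vec 0 1 2 0 0) (Vec 0 0 1 0 0) (Vec 0 0 0 1 0) (Vec 0 0 0 0 1),
    Mat (Vec 1 0 0 0 0) (Vec (-2) 1 0 0 0) (Vec 0 0 1 2 0) (Vec 0 0 0 1 0) (Vec 0 0 0 0 1),
    Mat (Vec 1 0 0 0 0) (Vec 2 1 0 0 0) (Vec 0 0 1 (-2) 0) (Vec 0 0 0 1 0) (Vec 0 0 0 0 1),
    Mat (Vec 1 2 0 0 0) (Vec 0 1 0 0 0) (Vec 0 0 1 0 0) (Vec 0 0 (-2) 1 0) (Vec 0 0 0 0 1),
    Mat (Vec 1 (-2) 0 0 0) (Vec 0 1 0 0 0) (Vec 0 0 1 0 0) (Vec 0 0 2 1 0) (Vec 0 0 0 0 1),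
    Mat (Vec (-3) 0 0 2 0) (Vec 0 (-3) (-2) 0 0) (Vec 0 2 1 0 0) (Vec (-2) 0 0 1 0) (Vec 0 0 0 0 1),
    Mat (Vec 1 0 0 0 0) (Vec 2 1 0 0 0) (Vec 4 2 1 (-2) 0) (Vec (-2) 0 0 1 0) (Vec 0 0 0 0 1),
    Mat (Vec 1 2 0 0 0) (Vec 0 1 0 0 0) (Vec 0 2 1 0 0) (Vec (-2) (-4) (-2) 1 0) (Vec 0 0 0 0 1),
    Mat (Vec 1 (-2) 0 0 0) (Vec 0 1 0 0 0) (Vec 0 2 1 0 0) (Vec (-2) 4 2 1 0) (Vec 0 0 0 0 1),
    Mat (Vec (-3) 0 0 (-2) 0) (Vec 0 (-3) 2 0 0) (Vec 0 (-2) 1 0 0) (Vec 2 0 0 1 0) (Vec 0 0 0 0 1),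
    Mat (Vec 1 (-2) 0 0 0) (Vec 0 1 0 0 0) (Vec 0 (-2) 1 0 0) (Vec 2 (-4) 2 1 0) (Vec 0 0 0 0 1),
    Mat (Vec 1 0 0 2 0) (Vec 2 1 (-2) 4 0) (Vec 0 0 1 (-2) 0) (Vec 0 0 0 1 0) (Vec 0 0 0 0 1),
    Mat (Vec 1 2 (-4) 2 0) (Vec 0 1 (-2) 0 0) (Vec 0 0 1 0 0) (Vec 0 0 (-2) 1 0) (Vec 0 0 0 0 1),
    Mat (Vec 1 (-2) 4 2 0) (Vec 0 1 (-2) 0 0) (Vec 0 0 1 0 0) (Vec 0 0 2 1 0) (Vec 0 0 0 0 1),
    Mat (Vec 1 (-2) (-4) (-2) 0) (Vec 0 1 2 0 0) (Vec 0 0 1 0 0) (Vec 0 0 2 1 0) (Vec 0 0 0 0 1),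
    Mat (Vec 5 0 0 (-2) 0) (Vec 0 5 2 0 0) (Vec 0 2 1 0 0) (Vec (-2) 0 0 1 0) (Vec 0 0 0 0 1),
    Mat (Vec 5 (-2) 0 0 0) (Vec (-2) 1 0 0 0) (Vec 0 0 1 2 0) (Vec 0 0 2 5 0) (Vec 0 0 0 0 1),
    Mat (Vec (-3) (-6) (-4) 2 0) (Vec 0 (-3) (-2) 0 0) (Vec 0 2 1 0 0)
        (Vec (-2) (-4) (-2) 1 0) (Vec 0 0 0 0 1),
    Mat (Vec (-3) 6 4 2 0) (Vec 0 (-3) (-2) 0 0) (Vec 0 2 1 0 0) (Vec (-2) 4 2 1 0) (Vec 0 0 0 0 1),
    Mat (Vec (-3) (-6) 4 (-2) 0) (Vec 0 (-3) 2 0 0) (Vec 0 (-2) 1 0 0) (Vec 2 4 (-2) 1 0)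
        (Vec 0 0 0 0 1)]"

definition same_coset :: "mat5 \<Rightarrow> mat5 \<Rightarrow> bool" where
  "same_coset g h \<longleftrightarrow> g * adj h \<in> Gam"

text \<open>By \<open>adj h = inverse h\<close> the coset relation is decided by evaluating a single product. The lists are
  the permutations of the cosets induced by the generators.\<close>

lemma table_x1:
  "list_all2 same_coset (map (\<lambda>t. t * s_x1) reps)
    (map ((!) reps) [1, 6, 0, 9, 19, 2, 10, 11, 12, 15, 5, 20, 7, 4, 8, 13, 21, 22, 23, 3, 14, 18, 16, 17])"
  by (simp add: reps_def s_x1_def same_coset_def cert cert_adj Gam_one [unfolded one_mat5_def])

lemma table_x2:
  "list_all2 same_coset (map (\<lambda>t. t * s_x2) reps)
    (map ((!) reps) [3, 9, 19, 6, 0, 4, 15, 16, 17, 10, 13, 21, 22, 2, 23, 5, 20, 7, 8, 1, 18, 14, 11, 12])"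
  by (simp add: reps_def s_x2_def same_coset_def cert cert_adj Gam_one [unfolded one_mat5_def])

lemma table_y1:
  "list_all2 same_coset (map (\<lambda>t. t * s_y1) reps)
    (map ((!) reps) [5, 2, 10, 4, 15, 6, 0, 8, 20, 19, 1, 12, 14, 9, 11, 3, 17, 18, 16, 13, 7, 22, 23, 21])"
  by (simp add: reps_def s_y1_def same_coset_def cert cert_adj Gam_one [unfolded one_mat5_def])

lemma table_y2:
  "list_all2 same_coset (map (\<lambda>t. t * s_y2) reps)
    (map ((!) reps) [7, 11, 12, 16, 17, 8, 20, 6, 0, 21, 14, 10, 1, 23, 2, 18, 15, 3, 4, 22, 5, 13, 9, 19])"
  by (simp add: reps_def s_y2_def same_coset_def cert cert_adj Gam_one [unfolded one_mat5_def])

lemma table_s1: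
  "list_all2 same_coset (map (\<lambda>t. t * s_s1) reps)
    (map ((!) reps) [10, 5, 6, 13, 9, 1, 2, 14, 11, 4, 0, 8, 20, 3, 7, 19, 23, 21, 22, 15, 12, 17, 18, 16])"
  by (simp add: reps_def s_s1_def same_coset_def cert cert_adj Gam_one [unfolded one_mat5_def])

lemma table_s2:
  "list_all2 same_coset (map (\<lambda>t. t * s_s2) reps)
    (map ((!) reps) [20, 14, 11, 18, 16, 7, 8, 5, 6, 23, 12, 2, 10, 22, 1, 17, 4, 15, 3, 21, 0, 19, 13, 9])"
  by (simp add: reps_def s_s2_def same_coset_def cert cert_adj Gam_one [unfolded one_mat5_def])

lemma table_s3:
  "list_all2 same_coset (map (\<lambda>t. t * s_s3) reps)
    (map ((!) reps) [20, 14, 11, 18, 16, 7, 8, 5, 6, 23, 12, 2, 10, 22, 1, 17, 4, 15, 3, 21, 0, 19, 13, 9])"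
  by (simp add: reps_def s_s3_def same_coset_def cert cert_adj Gam_one [unfolded one_mat5_def])

lemma table_s4:
  "list_all2 same_coset (map (\<lambda>t. t * s_s4) reps)
    (map ((!) reps) [15, 13, 9, 5, 6, 3, 4, 18, 16, 2, 19, 23, 21, 1, 22, 0, 8, 20, 7, 10, 17, 12, 14, 11])"
  by (simp add: reps_def s_s4_def same_coset_def cert cert_adj Gam_one [unfolded one_mat5_def])

lemma table_k1:
  "list_all2 same_coset (map (\<lambda>t. t * s_k1) reps)
    (map ((!) reps) [15, 13, 9, 5, 6, 3, 4, 18, 16, 2, 19, 23, 21, 1, 22, 0, 8, 20, 7, 10, 17, 12, 14, 11])"
  by (simp add: reps_def s_k1_def same_coset_def cert cert_adj Gam_one [unfolded one_mat5_def])

lemma table_k2: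
  "list_all2 same_coset (map (\<lambda>t. t * s_k2) reps)
    (map ((!) reps) [20, 14, 11, 18, 16, 7, 8, 5, 6, 23, 12, 2, 10, 22, 1, 17, 4, 15, 3, 21, 0, 19, 13, 9])"
  by (simp add: reps_def s_k2_def same_coset_def cert cert_adj Gam_one [unfolded one_mat5_def])

lemma table_k3:
  "list_all2 same_coset (map (\<lambda>t. t * s_k3) reps)
    (map ((!) reps) [0, 1, 2, 3, 4, 5, 6, 7, 8, 9, 10, 11, 12, 13, 14, 15, 16, 17, 18, 19, 20, 21, 22, 23])"
  by (simp add: reps_def s_k3_def same_coset_def cert cert_adj Gam_one [unfolded one_mat5_def])

lemma table_k4:
  "list_all2 same_coset (map (\<lambda>t. t * s_k4) reps)
    (map ((!) reps) [20, 14, 11, 18, 16, 7, 8, 5, 6, 23, 12, 2, 10, 22, 1, 17, 4, 15, 3, 21, 0, 19, 13, 9])"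
  by (simp add: reps_def s_k4_def same_coset_def cert cert_adj Gam_one [unfolded one_mat5_def])

lemma table_k5:
  "list_all2 same_coset (map (\<lambda>t. t * s_k5) reps)
    (map ((!) reps) [0, 1, 2, 3, 4, 5, 6, 7, 8, 9, 10, 11, 12, 13, 14, 15, 16, 17, 18, 19, 20, 21, 22, 23])"
  by (simp add: reps_def s_k5_def same_coset_def cert cert_adj Gam_one [unfolded one_mat5_def])

subsection \<open>Isometries and the stabiliser of the union of cosets\<close>

lemma app_times: "app (g * h) v = app g (app h v)"
  by (cases g rule: mat5_cases; cases h rule: mat5_cases; cases v) (simp add: algebra_simps)

lemma app_one [simp]: "app 1 v = v"
  by (cases v) (simp add: one_mat5_def)

fun form :: "vec5 \<Rightarrow> vec5 \<Rightarrow> int" where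
  "form (Vec p q r s t) (Vec p' q' r' s' t') = 9 * (p * r' + r * p' + q * s' + s * q') + t * t'"

fun vmod :: "vec5 \<Rightarrow> vec5" where
  "vmod (Vec p q r s t) = Vec (p mod 2) (q mod 2) (r mod 2) (s mod 2) (t mod 2)"

fun mmod :: "mat5 \<Rightarrow> mat5" where
  "mmod (Mat a b c d e) = Mat (vmod a) (vmod b) (vmod c) (vmod d) (vmod e)"

text \<open>Residues are kept as the integers 0 and 1, so the product of two reduced matrices has to
  be reduced once more.\<close>

lemma mmod_times: "mmod (g * h) = mmod (mmod g * mmod h)"
proof -
  have *: "(a * x + b * y + c * z + d * u + e * v) mod 2 =
    (a mod 2 * (x mod 2) + b mod 2 * (y mod 2) + c mod 2 * (z mod 2) + d mod 2 * (u mod 2) +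
      e mod 2 * (v mod 2)) mod 2" for a b c d e x y z u v :: int
    by (intro mod_add_cong mod_mult_cong) simp_all
  show ?thesis
    by (cases g rule: mat5_cases; cases h rule: mat5_cases) (simp, intro conjI *)
qed

lemma mmod_one [simp]: "mmod 1 = 1"
  by (simp add: one_mat5_def)

definition isometry :: "mat5 \<Rightarrow> bool" where
  "isometry g \<longleftrightarrow> (\<forall>u v. form (app g u) (app g v) = form u v)"

definition isom :: "mat5 set" where
  "isom = {g. isometry g \<and> (\<exists>g'. isometry g' \<and> g * g' = 1 \<and> g' * g = 1)}"

lemma isom_mult:
  assumes "g \<in> isom" "h \<in> isom"
  shows "g * h \<in> isom"
proof -
  obtain g' h' where *: "isometry g'" "g * g' = 1" "g' * g = 1" "isometry h'" "h * h' = 1" "h' * h = 1"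
    using assms by (auto simp: isom_def)
  have "g * h * (h' * g') = g * (h * h') * g'" "h' * g' * (g * h) = h' * (g' * g) * h"
    by (simp_all add: mult.assoc)
  then show ?thesis
    using * assms unfolding isom_def isometry_def by (auto simp: app_times intro!: exI [of _ "h' * g'"])
qed

lemma isom_inverse: "g \<in> isom \<Longrightarrow> g * h = 1 \<Longrightarrow> h \<in> isom"
  unfolding isom_def by simp (metis mult.assoc mult_1_left mult_1_right)

definition isom2 :: "mat5 set" where
  "isom2 = {g \<in> isom. mmod g = 1}"

lemma isom2_mult: "g \<in> isom2 \<Longrightarrow> h \<in> isom2 \<Longrightarrow> g * h \<in> isom2"
  using isom_mult by (auto simp: isom2_def mmod_times)

lemma isom2_inverse: "g \<in> isom2 \<Longrightarrow> g * h = 1 \<Longrightarrow> h \<in> isom2"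
  using mmod_times [of g h] mmod_times [of "1" h] isom_inverse by (auto simp: isom2_def)

section \<open>The union of cosets and its stabiliser\<close>

definition coset_union :: "mat5 set" where
  "coset_union = {g * t | g t. g \<in> Gam \<and> t \<in> set reps}"

text \<open>Stability is demanded for the inverse too, so that \<open>stab\<close> is a group and
  every move of the reduction can be undone.\<close>

definition stab :: "mat5 set" where
  "stab = {h \<in> isom2. \<exists>h'. h * h' = 1 \<and> h' * h = 1 \<and>
     (\<forall>x \<in> coset_union. x * h \<in> coset_union \<and> x * h' \<in> coset_union)}"

lemma stab_one: "1 \<in> stab"
  by (auto simp: stab_def isom2_def isom_def isometry_def intro!: exI [of _ 1])

lemma stab_mult:
  assumes "g \<in> stab" "h \<in> stab"
  shows "g * h \<in> stab"
proof -
  obtain g' h' where *: "g * g' = 1" "g' * g = 1" "h * h' = 1" "h' * h = 1"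
    "\<And>x. x \<in> coset_union \<Longrightarrow> x * g \<in> coset_union \<and> x * g' \<in> coset_union \<and>
      x * h \<in> coset_union \<and> x * h' \<in> coset_union"
    using assms by (auto simp: stab_def)
  have "g * h * (h' * g') = g * (h * h') * g'" "h' * g' * (g * h) = h' * (g' * g) * h"
    by (simp_all add: mult.assoc)
  then show ?thesis
    using * assms isom2_mult [of g h]
    by (auto simp: stab_def simp flip: mult.assoc intro!: exI [of _ "h' * g'"])
qed

lemma stab_inverse: "g \<in> stab \<Longrightarrow> g * h = 1 \<Longrightarrow> h \<in> stab"
  using isom2_inverse [of g h] unfolding stab_def
  by simp (metis mult.assoc mult_1_left mult_1_right)

lemma reps_adj: "t \<in> set reps \<Longrightarrow> adj t * t = 1"
  by (auto simp: reps_def one_mat5_def)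

lemma length_reps: "length reps = 24"
  by (simp add: reps_def)

lemma same_coset_reps:
  assumes "same_coset g t" "t \<in> set reps"
  obtains \<gamma> where "\<gamma> \<in> Gam" "g = \<gamma> * t"
  using assms reps_adj that [of "g * adj t"] by (simp add: same_coset_def mult.assoc)

text \<open>The table alone shows that the union is mapped into itself. Since its indices form a
  permutation, every coset is also the image of some coset, which gives stability under the
  inverse.\<close>

lemma stabI:
  assumes table: "list_all2 same_coset (map (\<lambda>t. t * s) reps) (map ((!) reps) \<pi>)"
    and perm: "sort \<pi> = [0..<24]"
    and s: "s * adj s = 1" "adj s * s = 1" "isometry s" "isometry (adj s)" "mmod s = 1"
  shows "s \<in> stab"
proof -
  have \<pi>: "set \<pi> = {..<24}"
    by (metis perm set_sort atLeast_upt)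
  have len: "length \<pi> = 24"
    using table length_reps by (auto dest: list_all2_lengthD)
  have *: "\<exists>\<gamma> \<in> Gam. reps ! i * s = \<gamma> * reps ! (\<pi> ! i)" if "i < 24" for i
  proof -
    have "same_coset (reps ! i * s) (reps ! (\<pi> ! i))"
      using list_all2_nthD [OF table, of i] that length_reps len by simp
    moreover have "\<pi> ! i < 24"
      using \<pi> nth_mem [of i \<pi>] that len by auto
    ultimately show ?thesis
      using same_coset_reps length_reps nth_mem by metis
  qed
  have "x * s \<in> coset_union" if x: "x \<in> coset_union" for x
  proof -
    obtain g i where g: "g \<in> Gam" "i < 24" "x = g * reps ! i"
      using x length_reps by (auto simp: coset_union_def in_set_conv_nth)
    obtain \<gamma> where "\<gamma> \<in> Gam" "reps ! i * s = \<gamma> * reps ! (\<pi> ! i)"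
      using * g by blast
    moreover have "reps ! (\<pi> ! i) \<in> set reps"
      using \<pi> nth_mem [of i \<pi>] g len length_reps by simp
    moreover have "x * s = (g * \<gamma>) * reps ! (\<pi> ! i)"
      using g calculation by (metis mult.assoc)
    ultimately show ?thesis
      using g Gam_mult by (auto simp: coset_union_def)
  qed
  moreover have "x * adj s \<in> coset_union" if x: "x \<in> coset_union" for x
  proof -
    obtain g j where g: "g \<in> Gam" "j < 24" "x = g * reps ! j"
      using x length_reps by (auto simp: coset_union_def in_set_conv_nth)
    then obtain i where i: "i < 24" "j = \<pi> ! i"
      using \<pi> len by (metis in_set_conv_nth lessThan_iff)
    obtain \<gamma> where \<gamma>: "\<gamma> \<in> Gam" "reps ! i * s = \<gamma> * reps ! j"
      using * i by blast
    obtain \<gamma>' where \<gamma>': "\<gamma>' \<in> Gam" "\<gamma>' * \<gamma> = 1"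
      using Gam_inverse [OF \<gamma>(1)] by blast
    have "reps ! j = \<gamma>' * (\<gamma> * reps ! j)"
      by (simp add: \<gamma>' flip: mult.assoc)
    then have "reps ! j * adj s = \<gamma>' * reps ! i * (s * adj s)"
      by (metis \<gamma>(2) mult.assoc)
    then have "x * adj s = g * \<gamma>' * reps ! i"
      using g s by (simp add: mult.assoc)
    moreover have "g * \<gamma>' \<in> Gam" "reps ! i \<in> set reps"
      using g \<gamma>' i Gam_mult length_reps by simp_all
    ultimately show ?thesis
      unfolding coset_union_def by blast
  qed
  ultimately show ?thesis
    using s unfolding stab_def isom2_def isom_def by blast
qed

lemma all_vec5: "(\<forall>v. P v) \<longleftrightarrow> (\<forall>p q r s t. P (Vec p q r s t))"
  by (metis vec5.exhaust)

lemma upt_24: "[0..<24] = [0,1,2,3,4,5,6,7,8,9,10,11,12,13,14,15,16,17,18,19,20,21,22,23]"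
  by code_simp

lemma s_x1_stab: "s_x1 \<in> stab"
  by (rule stabI [OF table_x1])
    (auto simp: s_x1_def isometry_def all_vec5 one_mat5_def upt_24 algebra_simps)

lemma s_x2_stab: "s_x2 \<in> stab"
  by (rule stabI [OF table_x2])
    (auto simp: s_x2_def isometry_def all_vec5 one_mat5_def upt_24 algebra_simps)

lemma s_y1_stab: "s_y1 \<in> stab"
  by (rule stabI [OF table_y1])
    (auto simp: s_y1_def isometry_def all_vec5 one_mat5_def upt_24 algebra_simps)

lemma s_y2_stab: "s_y2 \<in> stab"
  by (rule stabI [OF table_y2])
    (auto simp: s_y2_def isometry_def all_vec5 one_mat5_def upt_24 algebra_simps)

lemma s_s1_stab: "s_s1 \<in> stab"
  by (rule stabI [OF table_s1])
    (auto simp: s_s1_def isometry_def all_vec5 one_mat5_def upt_24 algebra_simps)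

lemma s_s2_stab: "s_s2 \<in> stab"
  by (rule stabI [OF table_s2])
    (auto simp: s_s2_def isometry_def all_vec5 one_mat5_def upt_24 algebra_simps)

lemma s_s3_stab: "s_s3 \<in> stab"
  by (rule stabI [OF table_s3])
    (auto simp: s_s3_def isometry_def all_vec5 one_mat5_def upt_24 algebra_simps)

lemma s_s4_stab: "s_s4 \<in> stab"
  by (rule stabI [OF table_s4])
    (auto simp: s_s4_def isometry_def all_vec5 one_mat5_def upt_24 algebra_simps)

lemma s_k1_stab: "s_k1 \<in> stab"
  by (rule stabI [OF table_k1])
    (auto simp: s_k1_def isometry_def all_vec5 one_mat5_def upt_24 algebra_simps)

lemma s_k2_stab: "s_k2 \<in> stab"
  by (rule stabI [OF table_k2])
    (auto simp: s_k2_def isometry_def all_vec5 one_mat5_def upt_24 algebra_simps)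

lemma s_k3_stab: "s_k3 \<in> stab"
  by (rule stabI [OF table_k3])
    (auto simp: s_k3_def isometry_def all_vec5 one_mat5_def upt_24 algebra_simps)

lemma s_k4_stab: "s_k4 \<in> stab"
  by (rule stabI [OF table_k4])
    (auto simp: s_k4_def isometry_def all_vec5 one_mat5_def upt_24 algebra_simps)

lemma s_k5_stab: "s_k5 \<in> stab"
  by (rule stabI [OF table_k5])
    (auto simp: s_k5_def isometry_def all_vec5 one_mat5_def upt_24 algebra_simps)

subsection \<open>The Euclidean algorithm on the first column\<close>

definition X1 :: "int \<Rightarrow> mat5" where
  "X1 k = Mat (Vec 1 0 0 0 0) (Vec 0 1 0 0 0) (Vec 0 (2*k) 1 0 0) (Vec (-2*k) 0 0 1 0)
      (Vec 0 0 0 0 1)"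
definition X2 :: "int \<Rightarrow> mat5" where
  "X2 k = Mat (Vec 1 0 0 (2*k) 0) (Vec 0 1 (-2*k) 0 0) (Vec 0 0 1 0 0) (Vec 0 0 0 1 0)
      (Vec 0 0 0 0 1)"
definition Y1 :: "int \<Rightarrow> mat5" where
  "Y1 k = Mat (Vec 1 0 0 0 0) (Vec (-2*k) 1 0 0 0) (Vec 0 0 1 (2*k) 0) (Vec 0 0 0 1 0)
      (Vec 0 0 0 0 1)"
definition Y2 :: "int \<Rightarrow> mat5" where
  "Y2 k = Mat (Vec 1 (2*k) 0 0 0) (Vec 0 1 0 0 0) (Vec 0 0 1 0 0) (Vec 0 0 (-2*k) 1 0)
      (Vec 0 0 0 0 1)"
text \<open>In this and the next three transvections the entry \<open>-18*k^2\<close> compensates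
  the norm \<open>(18*k)^2\<close> of the w-component, so that the moved basis vector stays
  isotropic.\<close>

definition S1 :: "int \<Rightarrow> mat5" where
  "S1 k = Mat (Vec 1 0 0 0 0) (Vec 0 1 0 0 0) (Vec (-18*k^2) 0 1 0 (18*k)) (Vec 0 0 0 1 0)
      (Vec (-2*k) 0 0 0 1)"
definition S2 :: "int \<Rightarrow> mat5" where
  "S2 k = Mat (Vec 1 0 (-18*k^2) 0 (18*k)) (Vec 0 1 0 0 0) (Vec 0 0 1 0 0) (Vec 0 0 0 1 0)
      (Vec 0 0 (-2*k) 0 1)"
definition S3 :: "int \<Rightarrow> mat5" where
  "S3 k = Mat (Vec 1 0 0 0 0) (Vec 0 1 0 0 0) (Vec 0 0 1 0 0) (Vec 0 (-18*k^2) 0 1 (18*k))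
      (Vec 0 (-2*k) 0 0 1)"
definition S4 :: "int \<Rightarrow> mat5" where
  "S4 k = Mat (Vec 1 0 0 0 0) (Vec 0 1 0 (-18*k^2) (18*k)) (Vec 0 0 1 0 0) (Vec 0 0 0 1 0)
      (Vec 0 0 0 (-2*k) 1)"

lemma one_parameter_stab:
  fixes F :: "int \<Rightarrow> mat5"
  assumes "F 0 = 1" "\<And>j k. F (j + k) = F j * F k" "F 1 \<in> stab"
  shows "F k \<in> stab"
proof (induction k rule: int_induct [where k = 0])
  case base
  show ?case using assms stab_one by simp
next
  case (step1 i)
  then show ?case using assms stab_mult by simp
next
  case (step2 i)
  have "F 1 * F (-1) = 1" using assms(2) [of 1 "-1"] assms(1) by simp
  then have "F (-1) \<in> stab" using stab_inverse assms by blast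
  then show ?case using step2 assms(2) [of i "-1"] stab_mult by simp
qed

lemma one_parameter_subgroups:
  "X1 k \<in> stab" "X2 k \<in> stab" "Y1 k \<in> stab" "Y2 k \<in> stab"
  "S1 k \<in> stab" "S2 k \<in> stab" "S3 k \<in> stab" "S4 k \<in> stab"
proof -
  note defs = X1_def X2_def Y1_def Y2_def S1_def S2_def S3_def S4_def
  have one: "X1 1 = s_x1" "X2 1 = s_x2" "Y1 1 = s_y1" "Y2 1 = s_y2"
    "S1 1 = s_s1" "S2 1 = s_s2" "S3 1 = s_s3" "S4 1 = s_s4"
    by (simp_all add: defs s_x1_def s_x2_def s_y1_def s_y2_def s_s1_def s_s2_def s_s3_def s_s4_def)
  note one = one s_x1_stab s_x2_stab s_y1_stab s_y2_stab s_s1_stab s_s2_stab s_s3_stab s_s4_stab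
  have zero: "X1 0 = 1" "X2 0 = 1" "Y1 0 = 1" "Y2 0 = 1" "S1 0 = 1" "S2 0 = 1" "S3 0 = 1" "S4 0 = 1"
    by (simp_all add: defs one_mat5_def)
  have add: "X1 (j + k) = X1 j * X1 k" "X2 (j + k) = X2 j * X2 k" "Y1 (j + k) = Y1 j * Y1 k"
    "Y2 (j + k) = Y2 j * Y2 k" "S1 (j + k) = S1 j * S1 k" "S2 (j + k) = S2 j * S2 k"
    "S3 (j + k) = S3 j * S3 k" "S4 (j + k) = S4 j * S4 k" for j k
    by (simp_all add: defs power2_eq_square algebra_simps)
  show "X1 k \<in> stab"
    by (rule one_parameter_stab [of X1]) (simp_all add: zero one, rule add)
  show "X2 k \<in> stab"
    by (rule one_parameter_stab [of X2]) (simp_all add: zero one, rule add)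
  show "Y1 k \<in> stab"
    by (rule one_parameter_stab [of Y1]) (simp_all add: zero one, rule add)
  show "Y2 k \<in> stab"
    by (rule one_parameter_stab [of Y2]) (simp_all add: zero one, rule add)
  show "S1 k \<in> stab"
    by (rule one_parameter_stab [of S1]) (simp_all add: zero one, rule add)
  show "S2 k \<in> stab"
    by (rule one_parameter_stab [of S2]) (simp_all add: zero one, rule add)
  show "S3 k \<in> stab"
    by (rule one_parameter_stab [of S3]) (simp_all add: zero one, rule add)
  show "S4 k \<in> stab"
    by (rule one_parameter_stab [of S4]) (simp_all add: zero one, rule add)
qed

section \<open>Moves fixing given vectors, and invariants of orbits\<close>

text \<open>The set \<open>S\<close> holds the columns that are already in place and must not be
  disturbed.\<close>

definition reach :: "vec5 set \<Rightarrow> vec5 \<Rightarrow> vec5 \<Rightarrow> bool" where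
  "reach S v w \<longleftrightarrow> (\<exists>h \<in> stab. (\<forall>u \<in> S. app h u = u) \<and> app h v = w)"

lemma reachI: "h \<in> stab \<Longrightarrow> (\<forall>u \<in> S. app h u = u) \<Longrightarrow> app h v = w \<Longrightarrow> reach S v w"
  unfolding reach_def by blast

lemma reach_refl: "reach S v v"
  by (rule reachI [OF stab_one]) simp_all

lemma reach_trans [trans]: "reach S u v \<Longrightarrow> reach S v w \<Longrightarrow> reach S u w"
  unfolding reach_def by (metis app_times stab_mult)

abbreviation "e1 \<equiv> Vec 1 0 0 0 0"
abbreviation "e2 \<equiv> Vec 0 1 0 0 0"
abbreviation "f1 \<equiv> Vec 0 0 1 0 0"
abbreviation "f2 \<equiv> Vec 0 0 0 1 0"
abbreviation "e0 \<equiv> Vec 0 0 0 0 1"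

text \<open>Isotropy, parity and primitivity of a column all follow from membership here, and
  \<open>orbit_reach\<close> carries membership through every move.\<close>

definition orbit :: "vec5 set \<Rightarrow> vec5 \<Rightarrow> vec5 set" where
  "orbit S u = {app g u | g. g \<in> isom2 \<and> (\<forall>x \<in> S. app g x = x)}"

lemma orbit_reach: "v \<in> orbit S u \<Longrightarrow> reach S v w \<Longrightarrow> w \<in> orbit S u"
proof -
  assume "v \<in> orbit S u" "reach S v w"
  then obtain g h where *: "g \<in> isom2" "\<forall>x \<in> S. app g x = x" "v = app g u" "h \<in> isom2"
    "\<forall>x \<in> S. app h x = x" "w = app h v"
    unfolding orbit_def reach_def stab_def by blast
  then have "w = app (h * g) u" "\<forall>x \<in> S. app (h * g) x = x" by (simp_all add: app_times)
  then show ?thesis using * isom2_mult unfolding orbit_def by blast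
qed

text \<open>The condition places \<open>u\<close> in 9 times the dual lattice, which every isometry
  preserves. Pairing with w then makes the w-coordinate of the image divisible by 9.\<close>

lemma form_dvd:
  assumes "g \<in> isom" "\<And>x. 9 dvd form u x"
  shows "9 dvd form (app g u) x"
proof -
  obtain g' where g': "isometry g" "g * g' = 1" using assms by (auto simp: isom_def)
  have "form (app g u) x = form (app g u) (app g (app g' x))"
    using g' by (simp flip: app_times)
  also have "\<dots> = form u (app g' x)" using g' by (simp add: isometry_def)
  finally show ?thesis using assms by simp
qed

text \<open>The first four coordinates alone are coprime: a common divisor d has d^2 dividing pr +
  qs, hence (3e)^2 by isotropy, so d divides 3e. The pairing with the image of \<open>u'\<close>
  then writes 1 as a sum of multiples of d.\<close>

lemma isotropic_image:
  assumes g: "g \<in> isom" and u: "\<And>x. 9 dvd form u x" "\<And>x. 9 dvd form u' x" "form u u = 0" "form u u' = 9"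
    and v: "app g u = Vec p q r s t"
  obtains e where "t = 9 * e" "2 * (p * r + q * s) + 9 * e\<^sup>2 = 0"
    "\<And>d. d dvd p \<Longrightarrow> d dvd q \<Longrightarrow> d dvd r \<Longrightarrow> d dvd s \<Longrightarrow> d dvd 1"
proof -
  obtain p' q' r' s' t' where w: "app g u' = Vec p' q' r' s' t'" using vec5.exhaust by blast
  have "9 dvd form (app g u) e0" "9 dvd form (app g u') e0"
    using form_dvd [OF g] u by blast+
  then obtain e e' where e: "t = 9 * e" "t' = 9 * e'" by (auto simp: v w elim!: dvdE)
  have iso: "form (app g u) (app g u) = 0" "form (app g u) (app g u') = 9"
    using g u by (auto simp: isom_def isometry_def)
  then have 1: "2 * (p * r + q * s) + 9 * e\<^sup>2 = 0"
    by (simp add: v w e power2_eq_square algebra_simps)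
  have 2: "p * r' + r * p' + q * s' + s * q' + 9 * e * e' = 1"
    using iso(2) by (simp add: v w e algebra_simps)
  have "d dvd 1" if d: "d dvd p" "d dvd q" "d dvd r" "d dvd s" for d
  proof -
    have "d\<^sup>2 dvd p * r + q * s"
      using d by (auto simp: power2_eq_square intro!: dvd_add mult_dvd_mono)
    then have "d\<^sup>2 dvd - 2 * (p * r + q * s)" by (rule dvd_mult)
    also have "- 2 * (p * r + q * s) = (3 * e)\<^sup>2" using 1 by (simp add: power2_eq_square)
    finally have "d dvd 3 * e" using pow_divides_pow_iff [of 2 d "3 * e"] by simp
    then have "d dvd 3 * e * (3 * e')" by (rule dvd_mult2)
    then have "d dvd p * r' + r * p' + q * s' + s * q' + 9 * e * e'"
      using d by (intro dvd_add) (auto simp: algebra_simps)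
    then show ?thesis by (simp only: 2)
  qed
  then show thesis using that e 1 by blast
qed

lemma form_basis_dvd: "9 dvd form e1 x" "9 dvd form e2 x" "9 dvd form f1 x" "9 dvd form f2 x"
  by (cases x; simp)+

lemma isom2_columns:
  assumes "mmod g = 1"
  shows "vmod (app g e1) = e1" "vmod (app g e2) = e2" "vmod (app g f1) = f1" "vmod (app g f2) = f2"
  using assms by (cases g rule: mat5_cases; simp add: one_mat5_def)+

lemma orbit_e1:
  assumes "Vec p q r s t \<in> orbit {} e1"
  obtains e where "t = 9 * e" "2 * (p * r + q * s) + 9 * e\<^sup>2 = 0" "odd p" "even q" "even r" "even s"
    "\<And>d. d dvd p \<Longrightarrow> d dvd q \<Longrightarrow> d dvd r \<Longrightarrow> d dvd s \<Longrightarrow> d dvd 1"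
proof -
  obtain g where g: "g \<in> isom" "mmod g = 1" "app g e1 = Vec p q r s t"
    using assms by (force simp: orbit_def isom2_def)
  have "odd p \<and> even q \<and> even r \<and> even s"
    using isom2_columns(1) [OF g(2)] g(3) by (simp add: even_iff_mod_2_eq_zero)
  then show thesis
    using isotropic_image [OF g(1) form_basis_dvd(1,3) _ _ g(3)] that by (simp, blast)
qed

section \<open>Even row and column operations\<close>

text \<open>Read (p, q, r, s) as the matrix with rows (p, q) and (-s, r), of determinant pr + qs.
  The first two moves are row operations and the last two column operations, always with even
  multipliers.\<close>

lemma reach_XY:
  "reach {} (Vec p q r s t) (Vec (p - 2*k*s) (q + 2*k*r) r s t)"
  "reach {} (Vec p q r s t) (Vec p q (r - 2*k*q) (s + 2*k*p) t)"
  "reach {} (Vec p q r s t) (Vec (p - 2*k*q) q r (s + 2*k*r) t)"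
  "reach {} (Vec p q r s t) (Vec p (q + 2*k*p) (r - 2*k*s) s t)"
  by (rule reachI [OF one_parameter_subgroups(1) [of k]], simp_all add: X1_def,
      rule reachI [OF one_parameter_subgroups(2) [of k]], simp_all add: X2_def,
      rule reachI [OF one_parameter_subgroups(3) [of k]], simp_all add: Y1_def,
      rule reachI [OF one_parameter_subgroups(4) [of k]], simp_all add: Y2_def)

text \<open>One step with \<open>k\<close> equal to 1 or -1, of sign opposite to
  \<open>a * b\<close>, suffices. The strict inequality will come from parity.\<close>

lemma abs_sub_twice_less:
  fixes a b :: int
  assumes "b \<noteq> 0" "\<bar>b\<bar> < \<bar>a\<bar>"
  obtains k where "\<bar>a + 2 * k * b\<bar> < \<bar>a\<bar>"
proof (cases "a * b > 0")
  case True
  then have "\<bar>a + 2 * (-1) * b\<bar> < \<bar>a\<bar>" using assms by (auto simp: zero_less_mult_iff)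
  then show thesis using that by blast
next
  case False
  then have "\<bar>a + 2 * 1 * b\<bar> < \<bar>a\<bar>"
    using assms by (auto simp: not_less mult_le_0_iff)
  then show thesis using that by blast
qed

lemma euclid_Y:
  assumes "Vec p q r s t \<in> orbit {} e1"
  shows "\<exists>p' r' s'. reach {} (Vec p q r s t) (Vec p' 0 r' s' t) \<and> p' dvd p \<and> p' dvd q"
  using assms
proof (induction "nat (\<bar>p\<bar> + \<bar>q\<bar>)" arbitrary: p q r s rule: less_induct)
  case less
  have pq: "odd p" "even q" using orbit_e1 [OF less.prems] by metis+
  \<comment> \<open>Opposite parity excludes equal absolute values, so an even step always decreases
    the sum and the run can stop only at \<open>q = 0\<close>.\<close>
  consider "q = 0" | "q \<noteq> 0" "\<bar>p\<bar> < \<bar>q\<bar>" | "q \<noteq> 0" "\<bar>q\<bar> < \<bar>p\<bar>"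
    using pq by (cases "\<bar>p\<bar>" "\<bar>q\<bar>" rule: linorder_cases) (auto simp: abs_eq_iff)
  then show ?case
  proof cases
    case 1
    then show ?thesis using reach_refl by fastforce
  next
    case 2
    then obtain k where k: "\<bar>q + 2 * k * p\<bar> < \<bar>q\<bar>"
      using abs_sub_twice_less pq by (metis even_zero)
    note R = reach_XY(4) [of p q r s t k]
    obtain p' r' s' where "reach {} (Vec p (q + 2*k*p) (r - 2*k*s) s t) (Vec p' 0 r' s' t)"
      "p' dvd p" "p' dvd q + 2*k*p"
      using less.hyps [OF _ orbit_reach [OF less.prems R]] k by fastforce
    moreover from this have "p' dvd q"
      by (metis dvd_add_left_iff dvd_mult)
    ultimately show ?thesis using reach_trans [OF R] by blast
  next
    case 3
    then obtain k where k: "\<bar>p + 2 * k * q\<bar> < \<bar>p\<bar>"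
      using abs_sub_twice_less by metis
    note R = reach_XY(3) [of p q r s t "-k"]
    obtain p' r' s' where "reach {} (Vec (p + 2*k*q) q r (s - 2*k*r) t) (Vec p' 0 r' s' t)"
      "p' dvd p + 2*k*q" "p' dvd q"
      using less.hyps [OF _ orbit_reach [OF less.prems R]] k by fastforce
    moreover from this have "p' dvd p"
      by (metis dvd_add_left_iff dvd_mult)
    ultimately show ?thesis using reach_trans [OF R] by fastforce
  qed
qed

lemma euclid_X:
  assumes "Vec p q r s t \<in> orbit {} e1"
  shows "\<exists>p' q' r'. reach {} (Vec p q r s t) (Vec p' q' r' 0 t) \<and> p' dvd p \<and> p' dvd s"
  using assms
proof (induction "nat (\<bar>p\<bar> + \<bar>s\<bar>)" arbitrary: p q r s rule: less_induct)
  case less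
  have pq: "odd p" "even s" using orbit_e1 [OF less.prems] by metis+
  consider "s = 0" | "s \<noteq> 0" "\<bar>p\<bar> < \<bar>s\<bar>" | "s \<noteq> 0" "\<bar>s\<bar> < \<bar>p\<bar>"
    using pq by (cases "\<bar>p\<bar>" "\<bar>s\<bar>" rule: linorder_cases) (auto simp: abs_eq_iff)
  then show ?case
  proof cases
    case 1
    then show ?thesis using reach_refl by fastforce
  next
    case 2
    then obtain k where k: "\<bar>s + 2 * k * p\<bar> < \<bar>s\<bar>"
      using abs_sub_twice_less pq by (metis even_zero)
    note R = reach_XY(2) [of p q r s t k]
    obtain p' q' r' where "reach {} (Vec p q (r - 2*k*q) (s + 2*k*p) t) (Vec p' q' r' 0 t)"
      "p' dvd p" "p' dvd s + 2*k*p"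
      using less.hyps [OF _ orbit_reach [OF less.prems R]] k by fastforce
    moreover from this have "p' dvd s"
      by (metis dvd_add_left_iff dvd_mult)
    ultimately show ?thesis using reach_trans [OF R] by blast
  next
    case 3
    then obtain k where k: "\<bar>p + 2 * k * s\<bar> < \<bar>p\<bar>"
      using abs_sub_twice_less by metis
    note R = reach_XY(1) [of p q r s t "-k"]
    obtain p' q' r' where "reach {} (Vec (p + 2*k*s) (q - 2*k*r) r s t) (Vec p' q' r' 0 t)"
      "p' dvd p + 2*k*s" "p' dvd s"
      using less.hyps [OF _ orbit_reach [OF less.prems R]] k by fastforce
    moreover from this have "p' dvd p"
      by (metis dvd_add_left_iff dvd_mult)
    ultimately show ?thesis using reach_trans [OF R] by fastforce
  qed
qed

lemma dvd_abs_less: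
  fixes a b c :: int
  assumes "a dvd b" "a dvd c" "\<not> b dvd c" "b \<noteq> 0"
  shows "\<bar>a\<bar> < \<bar>b\<bar>"
proof -
  have "\<bar>a\<bar> \<le> \<bar>b\<bar>" using assms dvd_imp_le_int by blast
  moreover have "\<bar>a\<bar> \<noteq> \<bar>b\<bar>" using assms by (metis abs_dvd_iff)
  ultimately show ?thesis by simp
qed

text \<open>Induction on |p|. If p fails to divide q or s, a Euclidean run replaces it by a proper
  divisor. Otherwise q and s can be cleared, and unless p is a unit, twice the third coordinate is
  copied into the second, where primitivity prevents p from dividing it.\<close>

lemma reach_unit:
  assumes "Vec p q r s t \<in> orbit {} e1"
  shows "\<exists>p' r'. \<bar>p'\<bar> = 1 \<and> reach {} (Vec p q r s t) (Vec p' 0 r' 0 t)"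
  using assms
proof (induction "nat \<bar>p\<bar>" arbitrary: p q r s rule: less_induct)
  case less
  note * = orbit_e1 [OF less.prems]
  have odd: "odd p" "even q" "even s" using * by metis+
  have step: ?case if R: "reach {} (Vec p q r s t) (Vec p q' r' s' t)" and n: "\<not> p dvd q'" for q' r' s'
  proof -
    obtain p1 r1 s1 where 1: "reach {} (Vec p q' r' s' t) (Vec p1 0 r1 s1 t)" "p1 dvd p" "p1 dvd q'"
      using euclid_Y [OF orbit_reach [OF less.prems R]] by blast
    then have "\<bar>p1\<bar> < \<bar>p\<bar>" using dvd_abs_less n odd by (metis even_zero)
    moreover have R1: "reach {} (Vec p q r s t) (Vec p1 0 r1 s1 t)" using reach_trans R 1 by blast
    ultimately show ?thesis
      using less.hyps [OF _ orbit_reach [OF less.prems R1]] reach_trans [OF R1] by fastforce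
  qed
  consider "\<not> p dvd s" | "\<not> p dvd q" | "p dvd s" "p dvd q" by blast
  then show ?case
  proof cases
    case 1
    obtain p1 q1 r1 where R: "reach {} (Vec p q r s t) (Vec p1 q1 r1 0 t)" "p1 dvd p" "p1 dvd s"
      using euclid_X [OF less.prems] by blast
    then have "\<bar>p1\<bar> < \<bar>p\<bar>" using dvd_abs_less 1 odd by (metis even_zero)
    then show ?thesis
      using less.hyps [OF _ orbit_reach [OF less.prems R(1)]] reach_trans [OF R(1)] by fastforce
  next
    case 2
    then show ?thesis using step reach_refl by blast
  next
    case 3
    then obtain m n where "s = p * m" "q = p * n" by (auto elim!: dvdE)
    \<comment> \<open>As p is odd, the quotients inherit the parity of s and q, so the even moves
      can clear both.\<close>
    moreover from this odd have "even m" "even n" by auto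
    ultimately obtain m n where mn: "s = p * (2 * m)" "q = p * (2 * n)" by (metis evenE)
    have R: "reach {} (Vec p q r s t) (Vec p q (r + 2*m*q) 0 t)"
      using reach_XY(2) [of p q r s t "-m"] by (simp add: mn algebra_simps)
    define r1 where "r1 = r + 2*m*q"
    have "reach {} (Vec p q r1 0 t) (Vec p 0 r1 0 t)"
      using reach_XY(4) [of p q r1 0 t "-n"] by (simp add: mn algebra_simps)
    then have R1: "reach {} (Vec p q r s t) (Vec p 0 r1 0 t)"
      using reach_trans R r1_def by blast
    show ?thesis
    proof (cases "\<bar>p\<bar> = 1")
      case True
      then show ?thesis using R1 by blast
    next
      case False
      \<comment> \<open>Only p and \<open>r1\<close> survive among the first four coordinates, so
        they are coprime; as p is odd, it cannot divide \<open>2 * r1\<close> unless it is a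
        unit.\<close>
      have "reach {} (Vec p 0 r1 0 t) (Vec p (2 * r1) r1 0 t)"
        using reach_XY(1) [of p 0 r1 0 t 1] by simp
      moreover have "\<not> p dvd 2 * r1"
      proof
        assume "p dvd 2 * r1"
        moreover have "coprime p 2" using odd by simp
        ultimately have "p dvd r1" using coprime_dvd_mult_right_iff by blast
        then have "p dvd 1" using orbit_e1 [OF orbit_reach [OF less.prems R1]] by (metis dvd_0_right dvd_refl)
        then show False using False by simp
      qed
      ultimately show ?thesis using step reach_trans [OF R1] by blast
    qed
  qed
qed

text \<open>With p' a unit and q = s = 0, isotropy gives t = 18k and r' = -18 p' k^2. This is the
  image of p' e1 under the transvection \<open>S2 (k * p')\<close>, whose inverse clears r' and t at
  once.\<close>

lemma reach_e1:
  assumes "v \<in> orbit {} e1"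
  obtains p where "\<bar>p\<bar> = 1" "reach {} v (Vec p 0 0 0 0)"
proof -
  obtain p q r s t where v: "v = Vec p q r s t" by (cases v)
  then obtain p' r' where R: "\<bar>p'\<bar> = 1" "reach {} v (Vec p' 0 r' 0 t)"
    using reach_unit assms by blast
  then obtain e where e: "t = 9 * e" "2 * (p' * r') + 9 * e\<^sup>2 = 0"
    using orbit_e1 [OF orbit_reach [OF assms R(2)]] by (metis add.right_neutral mult_zero_left)
  then have "even (9 * e\<^sup>2)" by (metis dvd_triv_left dvd_0_right even_add)
  then obtain k where k: "e = 2 * k" by auto
  have p': "p' * p' = 1" using R(1) by (metis abs_mult_self_eq mult_1)
  have "p' * r' = p' * p' * (-18 * k\<^sup>2)" using e k p' by (simp add: power2_eq_square)
  then have r': "r' = -18 * p' * k\<^sup>2" using p' by (metis R(1) abs_0 mult.assoc mult.commute mult_left_cancel zero_neq_one)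
  have "p' * (k * p') = k" "(k * p')\<^sup>2 * p' = k\<^sup>2 * p'"
    using p' by (simp_all add: power2_eq_square ac_simps)
  then have "reach {} (Vec p' 0 r' 0 t) (Vec p' 0 0 0 0)"
    by (intro reachI [OF one_parameter_subgroups(6) [of "- k * p'"]])
      (simp_all add: S2_def e(1) k r' power2_eq_square algebra_simps)
  then show thesis using that R reach_trans by blast
qed

subsection \<open>Reduction of the remaining columns\<close>

lemma orbitE:
  assumes "Vec p q r s t \<in> orbit S u" "\<And>x. 9 dvd form u x" "\<And>x. 9 dvd form u' x" "form u u = 0" "form u u' = 9"
  obtains g e where "g \<in> isom2" "\<And>x. x \<in> S \<Longrightarrow> app g x = x" "app g u = Vec p q r s t"
    "t = 9 * e" "2 * (p * r + q * s) + 9 * e\<^sup>2 = 0"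
    "\<And>d. d dvd p \<Longrightarrow> d dvd q \<Longrightarrow> d dvd r \<Longrightarrow> d dvd s \<Longrightarrow> d dvd 1"
proof -
  obtain g where g: "g \<in> isom2" "\<And>x. x \<in> S \<Longrightarrow> app g x = x" "app g u = Vec p q r s t"
    using assms(1) by (force simp: orbit_def)
  then have "g \<in> isom" by (simp add: isom2_def)
  from isotropic_image [OF this assms(2-5) g(3)] that [OF g] show thesis by blast
qed

lemma isom2_form: "g \<in> isom2 \<Longrightarrow> form (app g u) (app g v) = form u v"
  by (simp add: isom2_def isom_def isometry_def)

lemma orbit_f1:
  assumes "Vec p q r s t \<in> orbit {e1} f1"
  obtains e where "t = 9 * e" "2 * (p + q * s) + 9 * e\<^sup>2 = 0" "r = 1" "even q" "even s"
proof -
  obtain g e where g: "g \<in> isom2" "\<And>x. x \<in> {e1} \<Longrightarrow> app g x = x" "app g f1 = Vec p q r s t"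
    and e: "t = 9 * e" "2 * (p * r + q * s) + 9 * e\<^sup>2 = 0"
    by (rule orbitE [OF assms form_basis_dvd(3,1)]) auto
  have "r = 1" using isom2_form [OF g(1), of e1 f1] g(2) [of e1] g(3) by simp
  moreover have "even q \<and> even s"
    using isom2_columns(3) [of g] g by (simp add: isom2_def even_iff_mod_2_eq_zero)
  ultimately show thesis using that e by auto
qed

text \<open>Pairing with the fixed vector e1 gives r = 1. The moves \<open>X1\<close>,
  \<open>Y1\<close>, \<open>S1\<close> fix e1 and add multiples of r to q, s and t, which are
  thereby cleared; isotropy then forces the first coordinate to vanish.\<close>

lemma reach_f1:
  assumes "v \<in> orbit {e1} f1"
  shows "reach {e1} v f1"
proof -
  obtain p q r s t where v: "v = Vec p q r s t" by (cases v)
  note * = orbit_f1 [OF assms [unfolded v]]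
  obtain a b c where abc: "r = 1" "q = 2 * a" "s = 2 * b" "t = 18 * c"
  proof -
    obtain e where e: "t = 9 * e" "2 * (p + q * s) + 9 * e\<^sup>2 = 0" "r = 1" "even q" "even s"
      using * by blast
    then have "even (9 * e\<^sup>2)" by (metis dvd_triv_left dvd_0_right even_add)
    then have "even e" by simp
    then show thesis using that e by (auto elim!: evenE)
  qed
  define p1 where "p1 = p - 2 * (- a) * s"
  have "reach {e1} v (Vec p1 0 1 s t)"
    by (rule reachI [OF one_parameter_subgroups(1) [of "-a"]]) (simp_all add: X1_def v abc p1_def)
  also have "reach {e1} (Vec p1 0 1 s t) (Vec p1 0 1 0 t)"
    by (rule reachI [OF one_parameter_subgroups(3) [of "-b"]]) (simp_all add: Y1_def abc)
  also have "reach {e1} (Vec p1 0 1 0 t) (Vec (p1 + 18 * c\<^sup>2) 0 1 0 0)"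
    by (rule reachI [OF one_parameter_subgroups(5) [of "-c"]])
      (simp_all add: S1_def abc power2_eq_square)
  finally have R: "reach {e1} v (Vec (p1 + 18 * c\<^sup>2) 0 1 0 0)" .
  have "p1 + 18 * c\<^sup>2 = 0"
    by (rule orbit_f1 [OF orbit_reach [OF assms R]]) simp
  then show ?thesis using R by simp
qed

section \<open>Descent on isotropic vectors of 9U + <1>\<close>

text \<open>Orthogonality to the fixed vectors e1 and f1 confines the column to the span of e2, f2
  and w.\<close>

lemma orbit_e2:
  assumes "Vec p q r s t \<in> orbit {e1, f1} e2"
  obtains e where "t = 9 * e" "2 * q * s + 9 * e\<^sup>2 = 0" "p = 0" "r = 0" "odd q" "even s" "coprime q s"
proof -
  obtain g e where g: "g \<in> isom2" "\<And>x. x \<in> {e1, f1} \<Longrightarrow> app g x = x" "app g e2 = Vec p q r s t"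
    and e: "t = 9 * e" "2 * (p * r + q * s) + 9 * e\<^sup>2 = 0"
    and d: "\<And>d. d dvd p \<Longrightarrow> d dvd q \<Longrightarrow> d dvd r \<Longrightarrow> d dvd s \<Longrightarrow> d dvd 1"
    by (rule orbitE [OF assms form_basis_dvd(2,4)]) auto
  have pr: "r = 0" "p = 0"
    using isom2_form [OF g(1), of e1 e2] isom2_form [OF g(1), of f1 e2] g(2) [of e1] g(2) [of f1] g(3) by simp_all
  moreover have "odd q \<and> even s"
    using isom2_columns(2) [of g] g by (simp add: isom2_def even_iff_mod_2_eq_zero)
  moreover have "coprime q s"
    by (rule coprimeI) (use d pr in auto)
  ultimately show thesis using that e by auto
qed

text \<open>Real isotropic vectors here are multiples of (q, s, t) = (a^2, -2b^2, 6ab), so with t =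
  9e the cusp a/b equals -3e/s. The first move translates it by a multiple of 6. The others act on
  (a, b) by 2 x 2 matrices, and only s, which measures b^2, has to be followed.\<close>

lemma reach_K:
  "reach {e1, f1} (Vec 0 q 0 s (9 * e)) (Vec 0 (q - 18*k\<^sup>2*s - 18*k*e) 0 s (9 * (e + 2*k*s)))"
  "\<exists>q' t'. reach {e1, f1} (Vec 0 q 0 s (9 * e)) (Vec 0 q' 0 (s - 18*k\<^sup>2*q - 18*k*e) t')"
  "\<exists>q' t'. reach {e1, f1} (Vec 0 q 0 s (9 * e)) (Vec 0 q' 0 (-2*q + 9*s + 18*e) t')"
  "\<exists>q' t'. reach {e1, f1} (Vec 0 q 0 s (9 * e)) (Vec 0 q' 0 (-8*q + 9*s - 36*e) t')"
  "\<exists>q' t'. reach {e1, f1} (Vec 0 q 0 s (9 * e)) (Vec 0 q' 0 (-8*q + 9*s + 36*e) t')"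
  "\<exists>q' t'. reach {e1, f1} (Vec 0 q 0 s (9 * e)) (Vec 0 q' 0 (-32*q + 9*s - 72*e) t')"
  "\<exists>q' t'. reach {e1, f1} (Vec 0 q 0 s (9 * e)) (Vec 0 q' 0 (-32*q + 9*s + 72*e) t')"
proof -
  show "reach {e1, f1} (Vec 0 q 0 s (9 * e)) (Vec 0 (q - 18*k\<^sup>2*s - 18*k*e) 0 s (9 * (e + 2*k*s)))"
    by (rule reachI [OF one_parameter_subgroups(7) [of k]]) (simp_all add: S3_def algebra_simps)
  show "\<exists>q' t'. reach {e1, f1} (Vec 0 q 0 s (9 * e))
      (Vec 0 q' 0 (s - 18*k\<^sup>2*q - 18*k*e) t')"
    by (intro exI, rule reachI [OF one_parameter_subgroups(8) [of k]]) (simp_all add: S4_def algebra_simps)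
  show "\<exists>q' t'. reach {e1, f1} (Vec 0 q 0 s (9 * e)) (Vec 0 q' 0 (-2*q + 9*s + 18*e) t')"
    by (intro exI, rule reachI [OF s_k1_stab]) (simp_all add: s_k1_def)
  show "\<exists>q' t'. reach {e1, f1} (Vec 0 q 0 s (9 * e)) (Vec 0 q' 0 (-8*q + 9*s - 36*e) t')"
    by (intro exI, rule reachI [OF s_k2_stab]) (simp_all add: s_k2_def)
  show "\<exists>q' t'. reach {e1, f1} (Vec 0 q 0 s (9 * e)) (Vec 0 q' 0 (-8*q + 9*s + 36*e) t')"
    by (intro exI, rule reachI [OF s_k4_stab]) (simp_all add: s_k4_def)
  show "\<exists>q' t'. reach {e1, f1} (Vec 0 q 0 s (9 * e)) (Vec 0 q' 0 (-32*q + 9*s - 72*e) t')"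
    by (intro exI, rule reachI [OF s_k3_stab]) (simp_all add: s_k3_def)
  show "\<exists>q' t'. reach {e1, f1} (Vec 0 q 0 s (9 * e)) (Vec 0 q' 0 (-32*q + 9*s + 72*e) t')"
    by (intro exI, rule reachI [OF s_k5_stab]) (simp_all add: s_k5_def)
qed

lemma abs_less_of_square:
  fixes s s' a :: int
  assumes "s' * s = a\<^sup>2" "\<bar>a\<bar> < \<bar>s\<bar>"
  shows "\<bar>s'\<bar> < \<bar>s\<bar>"
proof -
  have "\<bar>s'\<bar> * \<bar>s\<bar> = \<bar>a\<bar> * \<bar>a\<bar>"
    using assms(1) by (simp add: power2_eq_square flip: abs_mult)
  also have "\<dots> < \<bar>s\<bar> * \<bar>s\<bar>"
    using assms(2) by (intro mult_strict_mono') auto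
  finally show ?thesis by (rule mult_right_less_imp_less) simp
qed

lemma centered_remainder:
  fixes e s :: int
  assumes "s \<noteq> 0"
  obtains k where "\<bar>e + 2 * k * s\<bar> \<le> \<bar>s\<bar>"
proof (cases "s > 0")
  case True
  define m where "m = (e + s) mod (2 * s)"
  have "e + 2 * (- ((e + s) div (2 * s))) * s = m - s"
    using minus_div_mult_eq_mod [of "e + s" "2 * s"] by (simp add: m_def algebra_simps)
  moreover have "0 \<le> m" "m < 2 * s" using True by (simp_all add: m_def)
  ultimately have "\<bar>e + 2 * (- ((e + s) div (2 * s))) * s\<bar> \<le> \<bar>s\<bar>" using True by linarith
  then show thesis by (rule that)
next
  case False
  define m where "m = (e - s) mod (2 * - s)"
  have "e + 2 * ((e - s) div (2 * - s)) * s = m + s"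
    using minus_div_mult_eq_mod [of "e - s" "2 * - s"] by (simp add: m_def algebra_simps)
  moreover have "0 \<le> m" "m < 2 * - s" using False assms by (simp_all add: m_def)
  ultimately have "\<bar>e + 2 * ((e - s) div (2 * - s)) * s\<bar> \<le> \<bar>s\<bar>" using False by linarith
  then show thesis by (rule that)
qed

text \<open>In terms of e/s the inequalities describe open intervals centred at the points 1/9, 1/4,
  1/2, 1 and their negatives. They cover [-1, 1] except for 0, 1/3, 2/3 and the negatives of
  these.\<close>

lemma descent_cases:
  fixes e s :: int
  assumes "s \<noteq> 0" "e \<noteq> 0" "\<bar>e\<bar> \<le> \<bar>s\<bar>"
    "s \<noteq> 3 * e" "s \<noteq> - 3 * e" "2 * s \<noteq> 3 * e" "2 * s \<noteq> - 3 * e"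
  shows "\<bar>s - 9 * e\<bar> < \<bar>s\<bar> \<or> \<bar>s + 9 * e\<bar> < \<bar>s\<bar> \<or> \<bar>3 * (4 * e - s)\<bar> < \<bar>s\<bar> \<or> \<bar>3 * (4 * e + s)\<bar> < \<bar>s\<bar> \<or>
    \<bar>3 * (2 * e - s)\<bar> < \<bar>s\<bar> \<or> \<bar>3 * (2 * e + s)\<bar> < \<bar>s\<bar> \<or> \<bar>3 * (e - s)\<bar> < \<bar>s\<bar> \<or> \<bar>3 * (e + s)\<bar> < \<bar>s\<bar>"
proof -
  have pos: "\<bar>s - 9 * e\<bar> < s \<or> \<bar>3 * (4 * e - s)\<bar> < s \<or> \<bar>3 * (2 * e - s)\<bar> < s \<or> \<bar>3 * (e - s)\<bar> < s"
    if "0 < e" "e \<le> s" "s \<noteq> 3 * e" "2 * s \<noteq> 3 * e" for e s :: int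
  proof -
    have "9 * e < 2 * s \<or> 2 * s \<le> 9 * e \<and> 3 * e < s \<or> s < 3 * e \<and> 3 * e < 2 * s \<or> 2 * s < 3 * e"
      using that(3,4) by arith
    then consider "9 * e < 2 * s" | "2 * s \<le> 9 * e" "3 * e < s" | "s < 3 * e" "3 * e < 2 * s" | "2 * s < 3 * e"
      by blast
    then show ?thesis
    proof cases
      case 1
      then have "\<bar>s - 9 * e\<bar> < s" using that by linarith
      then show ?thesis by blast
    next
      case 2
      then have "\<bar>3 * (4 * e - s)\<bar> < s" using that(1) by (simp add: abs_less_iff)
      then show ?thesis by blast
    next
      case 3
      then have "\<bar>3 * (2 * e - s)\<bar> < s" using that(1) by (simp add: abs_less_iff)
      then show ?thesis by blast
    next
      case 4
      then have "\<bar>3 * (e - s)\<bar> < s" using that(1,2) by (simp add: abs_less_iff)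
      then show ?thesis by blast
    qed
  qed
  consider "s > 0" "e > 0" | "s > 0" "e < 0" | "s < 0" "e > 0" | "s < 0" "e < 0"
    using assms by linarith
  then show ?thesis
  proof cases
    case 1
    then have "\<bar>s\<bar> = s" by simp
    then show ?thesis using pos [of e s] 1 assms by (metis abs_of_pos)
  next
    case 2
    have "\<bar>s - 9 * - e\<bar> < s \<or> \<bar>3 * (4 * - e - s)\<bar> < s \<or> \<bar>3 * (2 * - e - s)\<bar> < s \<or> \<bar>3 * (- e - s)\<bar> < s"
      by (rule pos) (use 2 assms in linarith)+
    moreover have "\<bar>s - 9 * - e\<bar> = \<bar>s + 9 * e\<bar>" "\<bar>3 * (4 * - e - s)\<bar> = \<bar>3 * (4 * e + s)\<bar>"
      "\<bar>3 * (2 * - e - s)\<bar> = \<bar>3 * (2 * e + s)\<bar>" "\<bar>3 * (- e - s)\<bar> = \<bar>3 * (e + s)\<bar>" "\<bar>s\<bar> = s"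
      using 2 by (auto simp: abs_eq_iff)
    ultimately show ?thesis by metis
  next
    case 3
    have "\<bar>- s - 9 * e\<bar> < - s \<or> \<bar>3 * (4 * e - - s)\<bar> < - s \<or> \<bar>3 * (2 * e - - s)\<bar> < - s \<or> \<bar>3 * (e - - s)\<bar> < - s"
      by (rule pos) (use 3 assms in linarith)+
    moreover have "\<bar>- s - 9 * e\<bar> = \<bar>s + 9 * e\<bar>" "\<bar>3 * (4 * e - - s)\<bar> = \<bar>3 * (4 * e + s)\<bar>"
      "\<bar>3 * (2 * e - - s)\<bar> = \<bar>3 * (2 * e + s)\<bar>" "\<bar>3 * (e - - s)\<bar> = \<bar>3 * (e + s)\<bar>" "\<bar>s\<bar> = - s"
      using 3 by (auto simp: abs_eq_iff)
    ultimately show ?thesis by metis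
  next
    case 4
    have "\<bar>- s - 9 * - e\<bar> < - s \<or> \<bar>3 * (4 * - e - - s)\<bar> < - s \<or> \<bar>3 * (2 * - e - - s)\<bar> < - s \<or> \<bar>3 * (- e - - s)\<bar> < - s"
      by (rule pos) (use 4 assms in linarith)+
    moreover have "\<bar>- s - 9 * - e\<bar> = \<bar>s - 9 * e\<bar>" "\<bar>3 * (4 * - e - - s)\<bar> = \<bar>3 * (4 * e - s)\<bar>"
      "\<bar>3 * (2 * - e - - s)\<bar> = \<bar>3 * (2 * e - s)\<bar>" "\<bar>3 * (- e - - s)\<bar> = \<bar>3 * (e - s)\<bar>" "\<bar>s\<bar> = - s"
      using 4 by (auto simp: abs_eq_iff)
    ultimately show ?thesis by metis
  qed
qed

text \<open>In \<open>9U \<oplus> \<langle>1\<rangle>\<close> each of the moves turns the coordinate \<open>s\<close> into \<open>s'\<close> with \<open>s' * s\<close> the square of a linear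
  form in \<open>e\<close> and \<open>s\<close>. After \<open>e\<close> has been reduced modulo \<open>2s\<close>, one of these squares is smaller than
  \<open>s\<^sup>2\<close>, because the boundary cases \<open>s = \<plusminus>3e\<close> and \<open>2s = \<plusminus>3e\<close> contradict coprimality or parity.\<close>

lemma K_descent:
  assumes v: "Vec 0 q 0 s t \<in> orbit {e1, f1} e2" and "s \<noteq> 0"
  obtains q' s' t' where "reach {e1, f1} (Vec 0 q 0 s t) (Vec 0 q' 0 s' t')" "\<bar>s'\<bar> < \<bar>s\<bar>"
proof -
  obtain e0 where e0: "t = 9 * e0" using orbit_e2 [OF v] by metis
  obtain k where k: "\<bar>e0 + 2 * k * s\<bar> \<le> \<bar>s\<bar>" using centered_remainder assms(2) by metis
  define e where "e = e0 + 2 * k * s"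
  define q1 where "q1 = q - 18*k\<^sup>2*s - 18*k*e0"
  have R: "reach {e1, f1} (Vec 0 q 0 s t) (Vec 0 q1 0 s (9 * e))"
    unfolding e0 e_def q1_def by (rule reach_K)
  have eq: "2 * q1 * s + 9 * e\<^sup>2 = 0" and q1: "odd q1" and cop: "coprime q1 s"
    using orbit_e2 [OF orbit_reach [OF v R]] by auto
  have e: "e \<noteq> 0" using eq q1 \<open>s \<noteq> 0\<close> by auto
  have no3: "\<not> (3 dvd q1 \<and> 3 dvd s)"
    using coprime_common_divisor [OF cop, of 3] by auto
  have "s \<noteq> 3 * e"
  proof
    assume s: "s = 3 * e"
    then have "e * (2 * q1 + 3 * e) = 0" using eq by (simp add: power2_eq_square algebra_simps)
    then have "2 * q1 + 3 * e = 0" using e by simp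
    then have "3 dvd q1 \<and> 3 dvd s" using s by presburger
    then show False using no3 by simp
  qed
  moreover have "s \<noteq> - 3 * e"
  proof
    assume s: "s = - 3 * e"
    then have "e * (- 2 * q1 + 3 * e) = 0" using eq by (simp add: power2_eq_square algebra_simps)
    then have "- 2 * q1 + 3 * e = 0" using e by simp
    then have "3 dvd q1 \<and> 3 dvd s" using s by presburger
    then show False using no3 by simp
  qed
  moreover have "2 * s \<noteq> 3 * e"
  proof
    assume s: "2 * s = 3 * e"
    have "q1 * (2 * s) + 9 * e\<^sup>2 = 0" using eq by (simp add: algebra_simps)
    then have "e * (3 * q1 + 9 * e) = 0" unfolding s by (simp add: power2_eq_square algebra_simps)
    then have "q1 = - 3 * e" using e by simp
    then show False using q1 s by presburger
  qed
  moreover have "2 * s \<noteq> - 3 * e"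
  proof
    assume s: "2 * s = - 3 * e"
    have "q1 * (2 * s) + 9 * e\<^sup>2 = 0" using eq by (simp add: algebra_simps)
    then have "e * (- 3 * q1 + 9 * e) = 0" unfolding s by (simp add: power2_eq_square algebra_simps)
    then have "q1 = 3 * e" using e by simp
    then show False using q1 s by presburger
  qed
  moreover have sq: "(s - 18*k\<^sup>2*q1 - 18*k*e) * s = (s - 9 * k * e)\<^sup>2" for k
  proof -
    have "9 * k\<^sup>2 * (2 * q1 * s + 9 * e\<^sup>2) = 0" using eq by simp
    then show ?thesis by (simp add: power2_eq_square algebra_simps)
  qed
  ultimately consider
    "\<bar>s - 9 * e\<bar> < \<bar>s\<bar>" | "\<bar>s + 9 * e\<bar> < \<bar>s\<bar>" | "\<bar>3 * (4 * e - s)\<bar> < \<bar>s\<bar>" | "\<bar>3 * (4 * e + s)\<bar> < \<bar>s\<bar>" |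
    "\<bar>3 * (2 * e - s)\<bar> < \<bar>s\<bar>" | "\<bar>3 * (2 * e + s)\<bar> < \<bar>s\<bar>" | "\<bar>3 * (e - s)\<bar> < \<bar>s\<bar>" | "\<bar>3 * (e + s)\<bar> < \<bar>s\<bar>"
    using descent_cases [of s e] assms(2) e k unfolding e_def by blast
  then have "\<exists>q' s' t'. reach {e1, f1} (Vec 0 q1 0 s (9 * e))
      (Vec 0 q' 0 s' t') \<and> \<bar>s'\<bar> < \<bar>s\<bar>"
  proof cases
    case 1
    then show ?thesis using reach_K(2) [of q1 s e 1] abs_less_of_square [OF sq [of 1]] by auto
  next
    case 2
    then show ?thesis using reach_K(2) [of q1 s e "-1"] abs_less_of_square [OF sq [of "-1"]] by auto
  next
    case 3
    \<comment> \<open>Sixteen times the isotropy equation replaces -32 q1 s by 144 e^2, which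
      completes the square.\<close>
    have "(-32*q1 + 9*s - 72*e) * s = (3 * (4 * e - s))\<^sup>2"
      using arg_cong [OF eq, of "(*) 16"] by (simp add: power2_eq_square algebra_simps)
    then show ?thesis using reach_K(6) [of q1 s e] abs_less_of_square 3 by blast
  next
    case 4
    have "(-32*q1 + 9*s + 72*e) * s = (3 * (4 * e + s))\<^sup>2"
      using arg_cong [OF eq, of "(*) 16"] by (simp add: power2_eq_square algebra_simps)
    then show ?thesis using reach_K(7) [of q1 s e] abs_less_of_square 4 by blast
  next
    case 5
    have "(-8*q1 + 9*s - 36*e) * s = (3 * (2 * e - s))\<^sup>2"
      using arg_cong [OF eq, of "(*) 4"] by (simp add: power2_eq_square algebra_simps)
    then show ?thesis using reach_K(4) [of q1 s e] abs_less_of_square 5 by blast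
  next
    case 6
    have "(-8*q1 + 9*s + 36*e) * s = (3 * (2 * e + s))\<^sup>2"
      using arg_cong [OF eq, of "(*) 4"] by (simp add: power2_eq_square algebra_simps)
    then show ?thesis using reach_K(5) [of q1 s e] abs_less_of_square 6 by blast
  next
    case 7
    \<comment> \<open>The move by \<open>s_k1\<close> is decreasing for e/s near -1; replacing e by
      e - 2s brings e/s from near 1 to that place.\<close>
    define q2 where "q2 = q1 - 18*(-1)\<^sup>2*s - 18*(-1)*e"
    have "reach {e1, f1} (Vec 0 q1 0 s (9 * e)) (Vec 0 q2 0 s (9 * (e + 2*(-1)*s)))"
      unfolding q2_def by (rule reach_K)
    moreover have "(-2*q2 + 9*s + 18*(e + 2*(-1)*s)) * s = (3 * (e - s))\<^sup>2"
      using eq by (simp add: q2_def power2_eq_square algebra_simps)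
    ultimately show ?thesis
      using reach_K(3) [of q2 s "e + 2*(-1)*s"] abs_less_of_square 7 reach_trans by blast
  next
    case 8
    have "(-2*q1 + 9*s + 18*e) * s = (3 * (e + s))\<^sup>2"
      using eq by (simp add: power2_eq_square algebra_simps)
    then show ?thesis using reach_K(3) [of q1 s e] abs_less_of_square 8 by blast
  qed
  then show thesis using that reach_trans [OF R] by blast
qed

text \<open>The descent ends at s = 0, where isotropy kills t and coprimality makes q a
  unit.\<close>

lemma reach_e2:
  assumes "v \<in> orbit {e1, f1} e2"
  obtains q where "\<bar>q\<bar> = 1" "reach {e1, f1} v (Vec 0 q 0 0 0)"
proof -
  have "\<exists>q'. \<bar>q'\<bar> = 1 \<and> reach {e1, f1} (Vec 0 q 0 s t) (Vec 0 q' 0 0 0)"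
    if "Vec 0 q 0 s t \<in> orbit {e1, f1} e2" for q s t
    using that
  proof (induction "nat \<bar>s\<bar>" arbitrary: q s t rule: less_induct)
    case less
    show ?case
    proof (cases "s = 0")
      case True
      obtain e where e: "t = 9 * e" "2 * q * s + 9 * e\<^sup>2 = 0" "coprime q s"
        using orbit_e2 [OF less.prems] by metis
      then have "t = 0" "\<bar>q\<bar> = 1" using True by auto
      then show ?thesis using True reach_refl by blast
    next
      case False
      then obtain q' s' t' where R: "reach {e1, f1} (Vec 0 q 0 s t)
      (Vec 0 q' 0 s' t')" "\<bar>s'\<bar> < \<bar>s\<bar>"
        using K_descent less.prems by blast
      then show ?thesis
        using less.hyps [OF _ orbit_reach [OF less.prems R(1)]] reach_trans [OF R(1)] by fastforce
    qed
  qed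
  moreover obtain q s t where "v = Vec 0 q 0 s t"
    using assms orbit_e2 by (metis vec5.exhaust)
  ultimately show thesis using that assms by blast
qed

text \<open>The pairings with the three fixed vectors leave only q and t free. A transvection fixing
  e2 clears t, and q then vanishes by isotropy.\<close>

lemma reach_f2:
  assumes "v \<in> orbit {e1, f1, e2} f2"
  shows "reach {e1, f1, e2} v f2"
proof -
  have *: "p = 0 \<and> r = 0 \<and> s = 1 \<and> (\<exists>e. t = 9 * e \<and> 2 * q + 9 * e\<^sup>2 = 0)"
    if v: "Vec p q r s t \<in> orbit {e1, f1, e2} f2" for p q r s t
  proof -
    obtain g e where g: "g \<in> isom2" "\<And>x. x \<in> {e1, f1, e2} \<Longrightarrow> app g x = x" "app g f2 = Vec p q r s t"
      and e: "t = 9 * e" "2 * (p * r + q * s) + 9 * e\<^sup>2 = 0"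
      by (rule orbitE [OF v form_basis_dvd(4,2)]) auto
    have "p = 0" "r = 0" "s = 1"
      using isom2_form [OF g(1), of e1 f2] isom2_form [OF g(1), of f1 f2] isom2_form [OF g(1), of e2 f2]
        g(2) [of e1] g(2) [of f1] g(2) [of e2] g(3) by simp_all
    then show ?thesis using e by auto
  qed
  obtain p q r s t where v: "v = Vec p q r s t" by (cases v)
  obtain e where e: "p = 0" "r = 0" "s = 1" "t = 9 * e" "2 * q + 9 * e\<^sup>2 = 0"
    using * assms v by blast
  then have "even (9 * e\<^sup>2)" by (metis dvd_triv_left dvd_0_right even_add)
  then obtain c where c: "e = 2 * c" by auto
  have "reach {e1, f1, e2} v (Vec 0 (q + 18 * c\<^sup>2) 0 1 0)"
    by (rule reachI [OF one_parameter_subgroups(7) [of "-c"]])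
      (simp_all add: S3_def v e c power2_eq_square)
  moreover have "q + 18 * c\<^sup>2 = 0" using e c by (simp add: power2_eq_square)
  ultimately show ?thesis by simp
qed

section \<open>Sign matrices and the reduction of a whole matrix\<close>

text \<open>e1 and f1 share a sign to keep their pairing, and so do e2 and f2. This group of order 8
  absorbs the units left by the reduction.\<close>

definition sign_mats :: "mat5 set" where
  "sign_mats = (\<lambda>(a, b, c). Mat (Vec a 0 0 0 0) (Vec 0 b 0 0 0) (Vec 0 0 a 0 0)
      (Vec 0 0 0 b 0) (Vec 0 0 0 0 c)) `
     ({1, -1} \<times> {1, -1} \<times> {1, -1})"

lemma finite_sign_mats: "finite sign_mats"
  by (simp add: sign_mats_def)

lemma sign_mats_mult: "d \<in> sign_mats \<Longrightarrow> d' \<in> sign_mats \<Longrightarrow> d * d' \<in> sign_mats"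
  by (auto simp: sign_mats_def)

lemma sign_mats_square: "d \<in> sign_mats \<Longrightarrow> d * d = 1"
  by (auto simp: sign_mats_def one_mat5_def)

lemma sign_mats_isom2: "d \<in> sign_mats \<Longrightarrow> d \<in> isom2"
proof -
  assume d: "d \<in> sign_mats"
  then have "isometry d" "mmod d = 1"
    by (auto simp: sign_mats_def isometry_def all_vec5 one_mat5_def)
  then show "d \<in> isom2"
    using sign_mats_square [OF d] by (auto simp: isom2_def isom_def)
qed

lemma app_unit_multiple:
  "app g e1 = Vec p 0 0 0 0 \<Longrightarrow> \<bar>p\<bar> = 1 \<Longrightarrow> app g
      (Vec p 0 0 0 0) = e1"
  "app g e2 = Vec 0 q 0 0 0 \<Longrightarrow> \<bar>q\<bar> = 1 \<Longrightarrow> app g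
      (Vec 0 q 0 0 0) = e2"
  by (cases g rule: mat5_cases; auto simp: abs_if split: if_splits)+

text \<open>Sign matrices need not lie in \<open>stab\<close>. Moves therefore act from the left,
  while signs are corrected from the right by \<open>reducible_right\<close>.\<close>

definition reducible :: "mat5 \<Rightarrow> bool" where
  "reducible g \<longleftrightarrow> (\<exists>h \<in> stab. \<exists>d \<in> sign_mats. h * g = d)"

lemma reducible_left: "h \<in> stab \<Longrightarrow> reducible (h * g) \<Longrightarrow> reducible g"
  unfolding reducible_def using stab_mult by (metis mult.assoc)

lemma reducible_right: "d \<in> sign_mats \<Longrightarrow> reducible (g * d) \<Longrightarrow> reducible g"
  unfolding reducible_def using sign_mats_mult sign_mats_square by (metis mult.assoc mult_1_right)

lemma stab_isom2: "h \<in> stab \<Longrightarrow> h \<in> isom2"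
  by (simp add: stab_def)

lemma isom2_reducible:
  assumes "g \<in> isom2"
  shows "reducible g"
proof -
  \<comment> \<open>The facts \<open>4\<close>, \<open>3\<close>, \<open>2\<close> run backwards
    through the order e1, f1, e2, f2 so that each can use the one before it; the number counts the
    column being treated.\<close>
  have 4: "reducible g" if g: "g \<in> isom2" "app g e1 = e1" "app g f1 = f1" "app g e2 = e2" for g
  proof -
    have "app g f2 \<in> orbit {e1, f1, e2} f2" using g by (auto simp: orbit_def)
    then obtain h where h: "h \<in> stab" "\<forall>u \<in> {e1, f1, e2}. app h u = u" "app h (app g f2) = f2"
      using reach_f2 by (auto simp: reach_def)
    define k where "k = h * g"
    have k: "k \<in> isom2" "app k e1 = e1" "app k f1 = f1" "app k e2 = e2" "app k f2 = f2"
      using g h isom2_mult stab_isom2 by (auto simp: k_def app_times)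
    obtain p q r s t where w: "app k e0 = Vec p q r s t" using vec5.exhaust by blast
    \<comment> \<open>The image of w is orthogonal to the four fixed basis vectors and has norm
      1.\<close>
    have "p = 0" "q = 0" "r = 0" "s = 0" "t * t = 1"
      using isom2_form [OF k(1), of e1 e0] isom2_form [OF k(1), of e2 e0] isom2_form [OF k(1), of f1 e0]
        isom2_form [OF k(1), of f2 e0] isom2_form [OF k(1), of e0 e0] k w by auto
    moreover from this have "t = 1 \<or> t = - 1" by (simp add: zmult_eq_1_iff)
    ultimately have "k = Mat e1 e2 f1 f2 (Vec 0 0 0 0 t)"
      using k w by (cases k rule: mat5_cases) auto
    then have "k \<in> sign_mats" using \<open>t = 1 \<or> t = - 1\<close> by (auto simp: sign_mats_def)
    then show ?thesis using h unfolding reducible_def k_def by blast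
  qed
  have 3: "reducible g" if g: "g \<in> isom2" "app g e1 = e1" "app g f1 = f1" for g
  proof -
    have "app g e2 \<in> orbit {e1, f1} e2" using g by (auto simp: orbit_def)
    then obtain q where q: "\<bar>q\<bar> = 1" "reach {e1, f1} (app g e2) (Vec 0 q 0 0 0)"
      by (rule reach_e2)
    then obtain h where h: "h \<in> stab" "\<forall>u \<in> {e1, f1}. app h u = u" "app h (app g e2) = Vec 0 q 0 0 0"
      unfolding reach_def by blast
    define d where "d = Mat e1 (Vec 0 q 0 0 0) f1 (Vec 0 0 0 q 0) e0"
    have de: "app d e1 = e1" "app d f1 = f1" "app d e2 = Vec 0 q 0 0 0"
      by (simp_all add: d_def)
    have d: "d \<in> sign_mats" using q(1) by (auto simp: d_def sign_mats_def)
    have "h * g * d \<in> isom2" using d g h isom2_mult stab_isom2 sign_mats_isom2 by blast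
    moreover have "app (h * g * d) e1 = e1" "app (h * g * d) f1 = f1"
      using g h de by (simp_all add: app_times)
    moreover have "app (h * g * d) e2 = e2"
    proof -
      have "app (h * g * d) e2 = app (h * g) (Vec 0 q 0 0 0)"
        by (simp add: app_times de)
      also have "\<dots> = e2"
        using app_unit_multiple(2) [of "h * g" q] h(3) q(1) by (simp add: app_times)
      finally show ?thesis .
    qed
    ultimately have "reducible (h * g * d)" by (rule 4)
    then show ?thesis using reducible_left reducible_right d h by blast
  qed
  have 2: "reducible g" if g: "g \<in> isom2" "app g e1 = e1" for g
  proof -
    have "app g f1 \<in> orbit {e1} f1" using g by (auto simp: orbit_def)
    then have "reach {e1} (app g f1) f1" by (rule reach_f1)
    then obtain h where h: "h \<in> stab" "\<forall>u \<in> {e1}. app h u = u" "app h (app g f1) = f1"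
      unfolding reach_def by blast
    have "reducible (h * g)"
      by (rule 3) (use g h isom2_mult stab_isom2 in \<open>auto simp: app_times\<close>)
    then show ?thesis using reducible_left h by blast
  qed
  have "app g e1 \<in> orbit {} e1" using assms by (auto simp: orbit_def)
  then obtain p where p: "\<bar>p\<bar> = 1" "reach {} (app g e1) (Vec p 0 0 0 0)"
    by (rule reach_e1)
  then obtain h where h: "h \<in> stab" "app h (app g e1) = Vec p 0 0 0 0"
    unfolding reach_def by blast
  define d where "d = Mat (Vec p 0 0 0 0) e2 (Vec 0 0 p 0 0) f2 e0"
  have d: "d \<in> sign_mats" using p(1) by (auto simp: d_def sign_mats_def)
  have "h * g * d \<in> isom2" using d assms h isom2_mult stab_isom2 sign_mats_isom2 by blast
  moreover have "app (h * g * d) e1 = e1"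
  proof -
    have "app (h * g * d) e1 = app (h * g) (app d e1)"
      by (simp only: app_times)
    also have "\<dots> = app (h * g) (Vec p 0 0 0 0)"
      by (simp add: d_def)
    also have "\<dots> = e1"
      using app_unit_multiple(1) [of "h * g" p] h(2) p(1) by (simp add: app_times)
    finally show ?thesis .
  qed
  ultimately have "reducible (h * g * d)" by (rule 2)
  then show ?thesis using reducible_left reducible_right d h by blast
qed

text \<open>The union contains 1, hence also \<open>1 * h'\<close> for the inverse of any
  \<open>h\<close> in \<open>stab\<close>. So \<open>stab\<close> itself lies in the union, and
  \<open>g\<close> differs from it by a sign matrix only.\<close>

lemma isom2_in_cosets:
  assumes "g \<in> isom2"
  obtains x d where "x \<in> coset_union" "d \<in> sign_mats" "g = x * d"
proof -
  obtain h d where h: "h \<in> stab" "d \<in> sign_mats" "h * g = d"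
    using isom2_reducible [OF assms] by (auto simp: reducible_def)
  obtain h' where h': "h' * h = 1" "\<forall>x \<in> coset_union. x * h' \<in> coset_union"
    using h(1) by (auto simp: stab_def)
  have "1 \<in> set reps" by (simp add: reps_def one_mat5_def)
  then have "1 \<in> coset_union" using Gam_one unfolding coset_union_def by force
  then have "h' \<in> coset_union" using h'(2) by force
  moreover have "g = h' * d" using h(3) h'(1) by (metis mult.assoc mult_1_left)
  ultimately show thesis using that h by blast
qed

section \<open>Passing from level 2 to the full integral orthogonal group\<close>

lemma finite_vmod: "finite (range vmod)"
proof (rule finite_subset)
  show "range vmod \<subseteq> (\<lambda>(p, q, r, s, t). Vec p q r s t) ` ({0..<2} \<times> {0..<2} \<times> {0..<2} \<times> {0..<2} \<times> {0..<2})"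
  proof
    fix w assume "w \<in> range vmod"
    then obtain p q r s t where "w = vmod (Vec p q r s t)" by (metis imageE vec5.exhaust)
    then show "w \<in> (\<lambda>(p, q, r, s, t). Vec p q r s t) ` ({0..<2} \<times> {0..<2} \<times> {0..<2} \<times> {0..<2} \<times> {0..<2})"
      by (intro image_eqI [of _ _ "(p mod 2, q mod 2, r mod 2, s mod 2, t mod 2)"]) simp_all
  qed
qed auto

lemma finite_mmod: "finite (range mmod)"
proof (rule finite_subset)
  show "range mmod \<subseteq> (\<lambda>(a, b, c, d, e). Mat a b c d e) `
    (range vmod \<times> range vmod \<times> range vmod \<times> range vmod \<times> range vmod)"
  proof
    fix w assume "w \<in> range mmod"
    then obtain a b c d e where "w = mmod (Mat a b c d e)" by (metis imageE mat5.exhaust)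
    then show "w \<in> (\<lambda>(a, b, c, d, e). Mat a b c d e) `
        (range vmod \<times> range vmod \<times> range vmod \<times> range vmod \<times> range vmod)"
      by (intro image_eqI [of _ _ "(vmod a, vmod b, vmod c, vmod d, vmod e)"]) auto
  qed
qed (auto simp: finite_vmod)

lemma isom_finite_index:
  obtains Y where "finite Y" "\<And>g. g \<in> isom \<Longrightarrow> \<exists>\<gamma> \<in> Gam. \<exists>y \<in> Y. g = \<gamma> * y"
proof -
  \<comment> \<open>If no isometry reduces to \<open>m\<close>, this is an arbitrary matrix, so
    \<open>Y\<close> may contain elements outside \<open>isom\<close>.\<close>
  define rep where "rep m = (SOME g. g \<in> isom \<and> mmod g = m)" for m
  define Y where "Y = (\<lambda>(t, d, m). t * d * rep m) ` (set reps \<times> sign_mats \<times> range mmod)"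
  have "finite Y" by (simp add: Y_def finite_sign_mats finite_mmod)
  moreover have "\<exists>\<gamma> \<in> Gam. \<exists>y \<in> Y. g = \<gamma> * y" if g: "g \<in> isom" for g
  proof -
    define r where "r = rep (mmod g)"
    have r: "r \<in> isom" "mmod r = mmod g"
      unfolding r_def rep_def by (rule someI2 [of _ g]; use g in simp)+
    then obtain r' where r': "r * r' = 1" "r' * r = 1" by (auto simp: isom_def)
    have "mmod (g * r') = mmod (mmod r * mmod r')"
      by (simp only: mmod_times [of g] r(2))
    also have "\<dots> = mmod (r * r')" by (rule mmod_times [symmetric])
    also have "\<dots> = 1" by (simp add: r')
    finally have "g * r' \<in> isom2"
      using isom_mult [OF g isom_inverse [OF r(1) r'(1)]] by (simp add: isom2_def)
    then obtain x d where x: "x \<in> coset_union" "d \<in> sign_mats" "g * r' = x * d"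
      by (rule isom2_in_cosets)
    then obtain \<gamma> t where t: "\<gamma> \<in> Gam" "t \<in> set reps" "x = \<gamma> * t"
      by (auto simp: coset_union_def)
    have "g = g * r' * r" using r' by (simp add: mult.assoc)
    also have "\<dots> = \<gamma> * (t * d * r)" by (simp add: x t mult.assoc)
    finally have "g = \<gamma> * (t * d * r)" .
    moreover have "t * d * r \<in> Y"
      unfolding Y_def r_def using x t by (intro image_eqI [of _ _ "(t, d, mmod g)"]) auto
    ultimately show ?thesis using t by blast
  qed
  ultimately show thesis using that by blast
qed

subsection \<open>Passage to complex matrices\<close>

fun comps :: "vec5 \<Rightarrow> int list" where
  "comps (Vec p q r s t) = [p, q, r, s, t]"

fun cols5 :: "mat5 \<Rightarrow> vec5 list" where
  "cols5 (Mat a b c d e) = [a, b, c, d, e]"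

definition imat :: "mat5 \<Rightarrow> int mat" where
  "imat g = mat 5 5 (\<lambda>(i, j). comps (cols5 g ! j) ! i)"

fun transp :: "mat5 \<Rightarrow> mat5" where
  "transp (Mat (Vec a1 a2 a3 a4 a5) (Vec b1 b2 b3 b4 b5) (Vec c1 c2 c3 c4 c5) (Vec d1 d2 d3 d4 d5)
      (Vec x1 x2 x3 x4 x5)) =
    Mat (Vec a1 b1 c1 d1 x1) (Vec a2 b2 c2 d2 x2) (Vec a3 b3 c3 d3 x3) (Vec a4 b4 c4 d4 x4)
      (Vec a5 b5 c5 d5 x5)"

lemma less_5: "i < 5 \<longleftrightarrow> i = 0 \<or> i = 1 \<or> i = 2 \<or> i = 3 \<or> i = (4::nat)"
  by auto

lemma all_less_5: "(\<forall>i<5. cob i) \<longleftrightarrow> cob 0 \<and> cob 1 \<and> cob 2 \<and> cob 3 \<and> cob (4::nat)"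
  by (auto simp: less_5)

lemma sum_5: "(\<Sum>i = 0..<5. f i) = f 0 + f 1 + f 2 + f 3 + f (4::nat)" for f :: "nat \<Rightarrow> 'a::comm_monoid_add"
  by (simp add: eval_nat_numeral add.assoc)

lemma mat5_eq_iff:
  "M \<in> carrier_mat 5 5 \<Longrightarrow> N \<in> carrier_mat 5 5 \<Longrightarrow>
    M = N \<longleftrightarrow> (\<forall>i<5. \<forall>j<5. M $$ (i, j) = N $$ (i, j))"
  by auto

lemma index_mult_5:
  fixes M N :: "'a::semiring_0 mat"
  assumes "M \<in> carrier_mat 5 5" "N \<in> carrier_mat 5 5" "i < 5" "j < 5"
  shows "(M * N) $$ (i, j) = M $$ (i, 0) * N $$ (0, j) + M $$ (i, 1) * N $$ (1, j) +
    M $$ (i, 2) * N $$ (2, j) + M $$ (i, 3) * N $$ (3, j) + M $$ (i, 4) * N $$ (4, j)"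
  using assms by (simp add: scalar_prod_def sum_5)

lemma imat_carrier [simp]: "imat g \<in> carrier_mat 5 5"
  by (simp add: imat_def)

lemma imat_index: "i < 5 \<Longrightarrow> j < 5 \<Longrightarrow> imat g $$ (i, j) = comps (cols5 g ! j) ! i"
  by (simp add: imat_def)

lemma imat_mult: "imat (g * h) = imat g * imat h"
proof -
  have "imat g * imat h \<in> carrier_mat 5 5" by (rule mult_carrier_mat [of _ _ 5]) simp_all
  then show ?thesis
    by (subst mat5_eq_iff, simp, simp, cases g rule: mat5_cases, cases h rule: mat5_cases)
      (simp add: index_mult_5 imat_index all_less_5 del: index_mult_mat)
qed

lemma imat_one: "imat 1 = 1\<^sub>m 5"
  by (subst mat5_eq_iff) (simp_all add: imat_index all_less_5 one_mat5_def)

lemma imat_transp: "imat (transp g) = transpose_mat (imat g)"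
  by (subst mat5_eq_iff, simp, simp, cases g rule: mat5_cases) (simp add: imat_def all_less_5)

lemma imat_inj: "imat g = imat h \<Longrightarrow> g = h"
  by (subst (asm) mat5_eq_iff, simp, simp, cases g rule: mat5_cases, cases h rule: mat5_cases)
    (simp add: imat_index all_less_5)

lemma imat_surj:
  assumes "M \<in> carrier_mat 5 5"
  obtains g where "imat g = M"
proof -
  define col where "col j = Vec (M $$ (0, j)) (M $$ (1, j)) (M $$ (2, j)) (M $$ (3, j)) (M $$ (4, j))" for j
  have "imat (Mat (col 0) (col 1) (col 2) (col 3) (col 4)) = M"
    using assms by (subst mat5_eq_iff) (simp_all add: imat_index all_less_5 col_def)
  then show thesis by (rule that)
qed

definition gram :: mat5 where
  "gram = Mat (Vec 0 0 9 0 0) (Vec 0 0 0 9 0) (Vec 9 0 0 0 0) (Vec 0 9 0 0 0) (Vec 0 0 0 0 1)"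

fun dot :: "vec5 \<Rightarrow> vec5 \<Rightarrow> int" where
  "dot (Vec p q r s t) (Vec p' q' r' s' t') = p * p' + q * q' + r * r' + s * s' + t * t'"

lemma dot_app: "dot (app g u) v = dot u (app (transp g) v)"
  by (cases g rule: mat5_cases; cases u; cases v) (simp add: algebra_simps)

lemma form_dot: "form u v = dot u (app gram v)"
  by (cases u; cases v) (simp add: gram_def algebra_simps)

lemma mat5_dot_eqI: "(\<And>u v. dot u (app g v) = dot u (app h v)) \<Longrightarrow> g = h"
proof -
  assume *: "\<And>u v. dot u (app g v) = dot u (app h v)"
  show "g = h"
    using *[of e1 e1] *[of e1 e2] *[of e1 f1] *[of e1 f2] *[of e1 e0]
      *[of e2 e1] *[of e2 e2] *[of e2 f1] *[of e2 f2] *[of e2 e0]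
      *[of f1 e1] *[of f1 e2] *[of f1 f1] *[of f1 f2] *[of f1 e0]
      *[of f2 e1] *[of f2 e2] *[of f2 f1] *[of f2 f2] *[of f2 e0]
      *[of e0 e1] *[of e0 e2] *[of e0 f1] *[of e0 f2] *[of e0 e0]
    by (cases g rule: mat5_cases; cases h rule: mat5_cases) simp
qed

lemma isometry_iff: "isometry g \<longleftrightarrow> transp g * gram * g = gram"
proof -
  have *: "form (app g u) (app g v) = dot u (app (transp g * gram * g) v)" for u v
    by (simp add: form_dot dot_app app_times)
  show ?thesis
  proof
    assume "isometry g"
    then show "transp g * gram * g = gram"
      by (intro mat5_dot_eqI) (simp only: isometry_def * [symmetric], simp only: form_dot)
  next
    assume "transp g * gram * g = gram"
    then show "isometry g" unfolding isometry_def by (simp only: * form_dot [symmetric]) simp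
  qed
qed

text \<open>The columns of \<open>cob\<close> are \<open>e\<^sub>1, e\<^sub>2, f\<^sub>1, f\<^sub>2, w\<close> in the standard basis.\<close>

definition cob :: mat5 where
  "cob = Mat (Vec (-1) (-1) 0 1 1) (Vec (-2) 0 2 1 (-1)) (Vec 0 1 1 (-1) (-1))
      (Vec 2 (-1) (-4) 0 3) (Vec 1 0 (-1) 0 1)"

definition cob_inv :: mat5 where
  "cob_inv = Mat (Vec 0 (-1) (-1) (-1) 1) (Vec (-1) 2 1 1 1) (Vec 1 (-1) 0 (-1) 1)
      (Vec (-1) 1 (-1) 0 1) (Vec 1 0 1 0 1)"

lemma cob_inverse: "cob * cob_inv = 1" "cob_inv * cob = 1"
  by (simp_all add: cob_def cob_inv_def one_mat5_def)

text \<open>This is \<open>g\<close> rewritten in the standard basis. As \<open>cob\<close> is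
  unimodular, conjugation by it is a bijection on integral matrices.\<close>

definition \<phi> :: "mat5 \<Rightarrow> complex mat" where
  "\<phi> g = map_mat of_int (imat (cob * g * cob_inv))"

lemma \<phi>_carrier [simp]: "\<phi> g \<in> carrier_mat 5 5"
  by (simp add: \<phi>_def)

lemma \<phi>_mult: "\<phi> (g * h) = \<phi> g * \<phi> h"
proof -
  have "cob * (g * h) * cob_inv = cob * g * cob_inv * (cob * h * cob_inv)"
    by (metis cob_inverse(2) mult.assoc mult_1_left)
  then show ?thesis
    unfolding \<phi>_def
    by (simp only: imat_mult [of "cob * g * cob_inv"] of_int_hom.mat_hom_mult [OF imat_carrier imat_carrier])
qed

lemma \<phi>_one: "\<phi> 1 = 1\<^sub>m 5"
  by (simp add: \<phi>_def cob_inverse imat_one of_int_hom.mat_hom_one)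

section \<open>The parameter polynomials and their companion matrices\<close>

text \<open>All roots are powers of the primitive twelfth root of unity \<open>w\<close>; the
  relation \<open>w ^ 4 = w\<^sup>2 - 1\<close> reduces every power that occurs to degree at most
  3.\<close>

lemma param_poly_alpha: "param_poly [0, 1/12, 5/12, 7/12, 11/12] = [:-1, 1, 1, -1, -1, 1:]"
  and param_poly_beta: "param_poly [1/2, 1/3, 1/3, 2/3, 2/3] = [:1, 3, 5, 5, 3, 1:]"
proof -
  define w where "w = exp (2 * of_real pi * \<i> * (1/12))"
  have w: "exp (2 * of_real pi * \<i> * (of_nat k / 12)) = w ^ k" for k
    unfolding w_def exp_of_nat_mult [symmetric] by (simp add: field_simps)
  have "w ^ 6 = exp (of_real pi * \<i>)"
    unfolding w [of 6, symmetric] by (simp add: field_simps)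
  then have w6: "w ^ 6 = - 1" by simp
  have "w\<^sup>2 = cis (pi / 3)"
    unfolding w [of 2, symmetric] cis_conv_exp by (simp add: field_simps)
  then have "Re (w\<^sup>2 + 1) = 3 / 2" by (simp add: cos_60)
  then have "w\<^sup>2 + 1 \<noteq> 0" by (metis zero_complex.simps(1) divide_eq_0_iff zero_neq_numeral)
  \<comment> \<open>This factors x^6 + 1; the real part 3/2 rules out the first factor.\<close>
  moreover have "(w\<^sup>2 + 1) * (w ^ 4 - w\<^sup>2 + 1) = 0"
    using w6 by (simp add: algebra_simps flip: power_add)
  ultimately have "w ^ 4 - w\<^sup>2 + 1 = 0" by (metis mult_eq_0_iff)
  then have "(w ^ 4 - w\<^sup>2 + 1) + (w\<^sup>2 - 1) = 0 + (w\<^sup>2 - 1)" by (simp only:)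
  then have w4: "w ^ 4 = w\<^sup>2 - 1" by simp
  have pow: "w ^ 5 = w ^ 3 - w" "w ^ 7 = - w" "w ^ 8 = - w\<^sup>2" "w ^ 11 = w - w ^ 3"
  proof -
    have "w ^ 5 = w * w ^ 4" "w ^ 7 = w * w ^ 6" "w ^ 8 = w\<^sup>2 * w ^ 6" "w ^ 11 = w ^ 4 * w * w ^ 6"
      by (simp_all flip: power_add power_Suc power_Suc2)
    then show "w ^ 5 = w ^ 3 - w" "w ^ 7 = - w" "w ^ 8 = - w\<^sup>2" "w ^ 11 = w - w ^ 3"
      by (simp_all add: w4 w6 algebra_simps power2_eq_square power3_eq_cube)
  qed
  have e: "exp (2 * of_real pi * \<i> * 0) = 1" "exp (2 * of_real pi * \<i> * (1/12)) = w" "exp (2 * of_real pi * \<i> * (5/12)) = w ^ 3 - w"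
    "exp (2 * of_real pi * \<i> * (7/12)) = - w" "exp (2 * of_real pi * \<i> * (11/12)) = w - w ^ 3"
    "exp (2 * of_real pi * \<i> * (1/2)) = - 1" "exp (2 * of_real pi * \<i> * (1/3)) = w\<^sup>2 - 1"
    "exp (2 * of_real pi * \<i> * (2/3)) = - w\<^sup>2"
    using w [of 1] w [of 5] w [of 7] w [of 11] w [of 6] w [of 4] w [of 8] by (simp_all add: pow w4 w6)
  have w': "w * (w * (w * w)) = w * w - 1" using w4 by (simp add: power2_eq_square eval_nat_numeral)
  have "(w ^ 3 - w)\<^sup>2 = w ^ 6 - 2 * w ^ 4 + w\<^sup>2"
    by (simp add: power2_eq_square eval_nat_numeral algebra_simps)
  then have sq: "(w ^ 3 - w)\<^sup>2 = 1 - w\<^sup>2" by (simp add: w4 w6)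
  \<comment> \<open>The four primitive twelfth roots form two pairs of opposite numbers, w, -w and
    w^5, -w^5, so their product is a polynomial in x^2.\<close>
  have 1: "[:-w, 1:] * [:w, 1:] = [:-w\<^sup>2, 0, 1:]"
    "[:w - w ^ 3, 1:] * [:w ^ 3 - w, 1:] = [:- ((w ^ 3 - w)\<^sup>2), 0, 1:]"
    by (simp_all add: power2_eq_square algebra_simps)
  show "param_poly [0, 1/12, 5/12, 7/12, 11/12] = [:-1, 1, 1, -1, -1, 1:]"
  proof -
    have "param_poly [0, 1/12, 5/12, 7/12, 11/12] =
      [:-1, 1:] * (([:-w, 1:] * [:w, 1:]) * ([:w - w ^ 3, 1:] * [:w ^ 3 - w, 1:]))"
      by (simp only: param_poly_def list.map prod_list.Cons prod_list.Nil e)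
        (simp only: minus_diff_eq minus_minus mult_1_left mult_1_right mult_ac)
    also have "\<dots> = [:-1, 1:] * ([:-w\<^sup>2, 0, 1:] * [:w\<^sup>2 - 1, 0, 1:])"
      by (simp only: 1 sq minus_diff_eq)
    also have "[:-w\<^sup>2, 0, 1:] * [:w\<^sup>2 - 1, 0, 1:] = [:1, 0, -1, 0, 1:]"
      using w' by (simp add: power2_eq_square algebra_simps)
    finally show ?thesis by simp
  qed
  have 2: "[:1 - w\<^sup>2, 1:] * [:w\<^sup>2, 1:] = [:1, 1, 1:]"
    using w' by (simp add: power2_eq_square algebra_simps)
  show "param_poly [1/2, 1/3, 1/3, 2/3, 2/3] = [:1, 3, 5, 5, 3, 1:]"
  proof -
    have "param_poly [1/2, 1/3, 1/3, 2/3, 2/3] =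
      [:1, 1:] * (([:1 - w\<^sup>2, 1:] * [:w\<^sup>2, 1:]) * ([:1 - w\<^sup>2, 1:] * [:w\<^sup>2, 1:]))"
      by (simp only: param_poly_def list.map prod_list.Cons prod_list.Nil e)
        (simp only: minus_diff_eq minus_minus mult_1_left mult_1_right mult_ac)
    then show ?thesis unfolding 2 by simp
  qed
qed

lemma companion_alpha: "companion_mat (param_poly [0, 1/12, 5/12, 7/12, 11/12]) = \<phi> gA"
proof -
  define p :: "complex poly" where "p = [:-1, 1, 1, -1, -1, 1:]"
  have p: "degree p = 5" "coeff p 0 = -1" "coeff p 1 = 1" "coeff p 2 = 1" "coeff p 3 = -1" "coeff p 4 = -1"
    by (simp_all add: p_def eval_nat_numeral)
  \<comment> \<open>Here \<open>e2\<close>, \<open>f1\<close>, \<open>f2\<close>, \<open>e0\<close>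
    merely abbreviate the second to fifth standard unit vectors, the first four columns of a
    companion matrix.\<close>
  have g: "cob * gA * cob_inv = Mat e2 f1 f2 e0 (Vec 1 (-1) (-1) 1 1)"
    by (simp add: cob_def cob_inv_def gA_def)
  show ?thesis
    unfolding param_poly_alpha p_def [symmetric] \<phi>_def g companion_mat_def Let_def p(1)
    by (subst mat5_eq_iff) (simp_all add: p imat_def all_less_5 p(3) [unfolded One_nat_def])
qed

lemma companion_beta: "companion_mat (param_poly [1/2, 1/3, 1/3, 2/3, 2/3]) = \<phi> (gA * gC)"
proof -
  define p :: "complex poly" where "p = [:1, 3, 5, 5, 3, 1:]"
  have p: "degree p = 5" "coeff p 0 = 1" "coeff p 1 = 3" "coeff p 2 = 5" "coeff p 3 = 5" "coeff p 4 = 3"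
    by (simp_all add: p_def eval_nat_numeral)
  have g: "cob * (gA * gC) * cob_inv = Mat e2 f1 f2 e0 (Vec (-1) (-3) (-5) (-5) (-3))"
    by (simp add: cob_def cob_inv_def gA_def gC_def)
  show ?thesis
    unfolding param_poly_beta p_def [symmetric] \<phi>_def g companion_mat_def Let_def p(1)
    by (subst mat5_eq_iff) (simp_all add: p imat_def all_less_5 p(3) [unfolded One_nat_def])
qed

lemma GL_mult [simp]: "M \<otimes>\<^bsub>GL n\<^esub> N = M * N" and GL_one [simp]: "\<one>\<^bsub>GL n\<^esub> = 1\<^sub>m n"
  by (simp_all add: GL_def units_of_def ring_mat_simps)

lemma GL_carrier:
  "M \<in> carrier (GL n) \<longleftrightarrow>
    M \<in> carrier_mat n n \<and> (\<exists>N \<in> carrier_mat n n. N * M = 1\<^sub>m n \<and> M * N = 1\<^sub>m n)"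
  by (simp add: GL_def units_of_def Units_def ring_mat_simps)

lemma group_GL: "group (GL n :: 'a::comm_ring_1 mat monoid)"
proof -
  interpret ring "ring_mat TYPE('a) n ()" by (rule ring_mat)
  show ?thesis unfolding GL_def by (rule units_group)
qed

lemma \<phi>_units:
  assumes "g * h = 1" "h * g = 1"
  shows "\<phi> g \<in> carrier (GL 5) \<inter> GL_int 5"
proof -
  define g' h' where gh: "g' = cob * g * cob_inv" "h' = cob * h * cob_inv"
  have "g' * h' = cob * g * (cob_inv * cob) * h * cob_inv" "h' * g' = cob * h * (cob_inv * cob) * g * cob_inv"
    by (simp_all only: gh mult.assoc)
  then have "g' * h' = cob * (g * h) * cob_inv" "h' * g' = cob * (h * g) * cob_inv"
    by (simp_all only: cob_inverse mult_1_right mult.assoc)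
  then have inv: "g' * h' = 1" "h' * g' = 1"
    using assms by (simp_all only: mult_1_right cob_inverse)
  then have "imat g' * imat h' = 1\<^sub>m 5" "imat h' * imat g' = 1\<^sub>m 5"
    by (simp_all only: imat_one flip: imat_mult)
  then have "imat g' \<in> carrier (GL 5)"
    by (auto simp: GL_carrier intro!: bexI [of _ "imat h'"])
  then have "\<phi> g \<in> GL_int 5"
    unfolding GL_int_def \<phi>_def gh(1) [symmetric] by (rule imageI)
  moreover have "\<phi> g \<in> carrier (GL 5)"
    using assms by (auto simp: GL_carrier \<phi>_one simp flip: \<phi>_mult intro!: bexI [of _ "\<phi> h"])
  ultimately show ?thesis by blast
qed

lemma GL_int_\<phi>:
  assumes "M \<in> GL_int 5"
  obtains g h where "M = \<phi> g" "g * h = 1" "h * g = 1"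
proof -
  obtain K N where K: "M = map_mat of_int K" "K \<in> carrier_mat 5 5" "N \<in> carrier_mat 5 5"
    "N * K = 1\<^sub>m 5" "K * N = 1\<^sub>m 5"
    using assms by (auto simp: GL_int_def GL_carrier)
  obtain k n where kn: "imat k = K" "imat n = N"
    using imat_surj K(2,3) by metis
  have 1: "n * k = 1" "k * n = 1"
    using K(4,5) by (auto intro!: imat_inj simp: imat_mult imat_one kn simp del: times_mat5.simps)
  have "cob * (cob_inv * k * cob) * cob_inv = (cob * cob_inv) * k * (cob * cob_inv)" by (simp only: mult.assoc)
  then have "M = \<phi> (cob_inv * k * cob)"
    by (simp add: \<phi>_def K kn cob_inverse del: times_mat5.simps)
  moreover have "(cob_inv * k * cob) * (cob_inv * n * cob) = cob_inv * k * (cob * cob_inv) * n * cob"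
    "(cob_inv * n * cob) * (cob_inv * k * cob) = cob_inv * n * (cob * cob_inv) * k * cob"
    by (simp_all only: mult.assoc)
  then have "(cob_inv * k * cob) * (cob_inv * n * cob) = 1" "(cob_inv * n * cob) * (cob_inv * k * cob) = 1"
    using 1 by (simp_all only: cob_inverse mult_1_right mult.assoc)
  ultimately show thesis by (rule that)
qed

section \<open>The invariant form in the standard basis\<close>

text \<open>The Toeplitz entries 19, -17, 10, 1, -8 are the solution of the linear system in
  \<open>invariant_form_unique\<close>, scaled to \<open>q 0 = 19\<close>.\<close>

definition Q5 :: mat5 where
  "Q5 = Mat (Vec 19 (-17) 10 1 (-8)) (Vec (-17) 19 (-17) 10 1) (Vec 10 (-17) 19 (-17) 10)
    (Vec 1 10 (-17) 19 (-17)) (Vec (-8) 1 10 (-17) 19)"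

definition Q0 :: "rat mat" where
  "Q0 = map_mat of_int (imat Q5)"

lemma Q0_carrier [simp]: "Q0 \<in> carrier_mat 5 5"
  by (simp add: Q0_def)

lemma Q0_complex: "map_mat of_rat Q0 = (map_mat of_int (imat Q5) :: complex mat)"
  by (subst mat5_eq_iff) (simp_all add: Q0_def imat_def)

lemma gram_Q5: "transp cob * Q5 * cob = gram"
  by (simp add: cob_def Q5_def gram_def)

lemma transp_mult: "transp (g * h) = transp h * transp g"
  by (cases g rule: mat5_cases; cases h rule: mat5_cases) (simp add: mult.commute)

lemma \<phi>_preserves_iff:
  "transpose_mat (\<phi> g) * map_mat of_rat Q0 * \<phi> g = map_mat of_rat Q0 \<longleftrightarrow> isometry g"
proof -
  define k where "k = cob * g * cob_inv"
  have "transpose_mat (\<phi> g) * map_mat of_rat Q0 * \<phi> g = map_mat of_int (imat (transp k * Q5 * k))"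
    unfolding \<phi>_def k_def [symmetric] Q0_complex map_mat_transpose imat_transp [symmetric]
    by (simp only: imat_mult [of "transp k * Q5" k] imat_mult [of "transp k" Q5]
        of_int_hom.mat_hom_mult [OF imat_carrier imat_carrier]
        of_int_hom.mat_hom_mult [OF mult_carrier_mat [OF imat_carrier imat_carrier] imat_carrier])
  also have "\<dots> = map_mat of_rat Q0 \<longleftrightarrow> transp k * Q5 * k = Q5"
    unfolding Q0_complex by (auto dest!: of_int_hom.mat_hom_inj imat_inj simp del: times_mat5.simps)
  also have "\<dots> \<longleftrightarrow> transp g * gram * g = gram"
  proof
    assume "transp k * Q5 * k = Q5"
    then have "transp cob * (transp k * Q5 * k) * cob = gram"
      by (simp only: gram_Q5)
    moreover have "k * cob = cob * g"
      by (simp only: k_def mult.assoc cob_inverse mult_1_right)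
    moreover have "transp cob * (transp k * Q5 * k) * cob = transp (k * cob) * Q5 * (k * cob)"
      by (simp only: transp_mult mult.assoc)
    moreover have "transp (cob * g) * Q5 * (cob * g) = transp g * (transp cob * Q5 * cob) * g"
      by (simp only: transp_mult mult.assoc)
    ultimately show "transp g * gram * g = gram"
      by (simp only: gram_Q5)
  next
    assume g: "transp g * gram * g = gram"
    have Q5: "Q5 = transp cob_inv * gram * cob_inv"
      by (simp add: cob_inv_def Q5_def gram_def)
    have "transp k * Q5 * k = transp cob_inv * (transp g * (transp cob * Q5 * cob) * g) * cob_inv"
      by (simp only: k_def transp_mult mult.assoc)
    then have "transp k * Q5 * k = transp cob_inv * gram * cob_inv"
      by (simp only: gram_Q5 g)
    then show "transp k * Q5 * k = Q5"
      by (simp only: Q5 [symmetric])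
  qed
  finally show ?thesis by (simp only: isometry_iff)
qed

lemma isometry_inverse: "isometry g \<Longrightarrow> g * h = 1 \<Longrightarrow> isometry h"
  unfolding isometry_def by (metis app_one app_times)

lemma orthogonal_int_eq: "orthogonal_group 5 Q0 \<inter> GL_int 5 = \<phi> ` isom"
proof (intro equalityI subsetI)
  fix M assume M: "M \<in> orthogonal_group 5 Q0 \<inter> GL_int 5"
  then obtain g h where g: "M = \<phi> g" "g * h = 1" "h * g = 1"
    using GL_int_\<phi> by blast
  then have "isometry g" using M \<phi>_preserves_iff by (auto simp: orthogonal_group_def)
  then have "g \<in> isom" using g isometry_inverse by (auto simp: isom_def)
  then show "M \<in> \<phi> ` isom" using g by blast
next
  fix M assume "M \<in> \<phi> ` isom"
  then obtain g h where g: "M = \<phi> g" "g * h = 1" "h * g = 1" "isometry g"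
    by (auto simp: isom_def)
  then show "M \<in> orthogonal_group 5 Q0 \<inter> GL_int 5"
    using \<phi>_units [of g h] \<phi>_preserves_iff by (auto simp: orthogonal_group_def)
qed

lemma \<phi>_inv:
  assumes "g * h = 1" "h * g = 1"
  shows "inv\<^bsub>GL 5\<^esub> (\<phi> g) = \<phi> h"
  by (rule group.inv_equality [OF group_GL])
    (use assms \<phi>_units [of g h] \<phi>_units [of h g] in \<open>auto simp: \<phi>_one simp flip: \<phi>_mult\<close>)

lemma subgroup_isom: "subgroup (\<phi> ` isom) (GL 5)"
proof (rule group.subgroupI [OF group_GL])
  show "\<phi> ` isom \<subseteq> carrier (GL 5)"
    using \<phi>_units by (auto simp: isom_def)
  show "\<phi> ` isom \<noteq> {}"
    using sign_mats_isom2 [of 1] by (auto simp: isom2_def sign_mats_def one_mat5_def)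
  show "inv\<^bsub>GL 5\<^esub> M \<in> \<phi> ` isom" if M: "M \<in> \<phi> ` isom" for M
  proof -
    obtain g where g: "M = \<phi> g" "g \<in> isom" using M by blast
    moreover from this obtain h where "g * h = 1" "h * g = 1" by (auto simp: isom_def)
    ultimately show ?thesis using \<phi>_inv isom_inverse by auto
  qed
  show "M \<otimes>\<^bsub>GL 5\<^esub> N \<in> \<phi> ` isom" if "M \<in> \<phi> ` isom" "N \<in> \<phi> ` isom" for M N
    using that isom_mult by (auto simp flip: \<phi>_mult)
qed

section \<open>The hypergeometric group inside the integral orthogonal group\<close>

abbreviation "hgroup \<equiv> hypergeometric_group [0, 1/12, 5/12, 7/12, 11/12] [1/2, 1/3, 1/3, 2/3, 2/3]"

lemma hgroup_eq: "hgroup = generate (GL 5) {\<phi> gA, \<phi> (gA * gC)}"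
  unfolding hypergeometric_group_def companion_alpha companion_beta
  by (simp add: eval_nat_numeral)

lemma gA_isom: "gA \<in> isom" and gC_isom: "gC \<in> isom"
proof -
  have "isometry gA" "isometry gC" "isometry (adj gA)"
    by (simp_all add: isometry_def all_vec5 gA_def gC_def algebra_simps)
  moreover have "gA * adj gA = 1" "adj gA * gA = 1"
    by (simp_all add: gA_def one_mat5_def)
  ultimately show "gA \<in> isom" "gC \<in> isom"
    using gC_square by (auto simp: isom_def)
qed

lemma hgroup_subset: "hgroup \<subseteq> \<phi> ` isom"
  unfolding hgroup_eq
  by (rule group.generate_subgroup_incl [OF group_GL _ subgroup_isom])
    (use gA_isom gC_isom isom_mult in auto)

lemma subgroup_hgroup: "subgroup hgroup (GL 5)"
  unfolding hgroup_eq
  by (rule group.generate_is_subgroup [OF group_GL])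
    (use gA_isom gC_isom isom_mult subgroup.subset [OF subgroup_isom] in blast)

lemma Gam_hgroup: "g \<in> Gam \<Longrightarrow> \<phi> g \<in> hgroup"
proof (induction rule: Gam.induct)
  case Gam_one
  show ?case using subgroup.one_closed [OF subgroup_hgroup] by (simp add: \<phi>_one)
next
  case (Gam_A g)
  have "\<phi> gA \<in> hgroup" unfolding hgroup_eq by (rule generate.incl) simp
  then show ?case
    using subgroup.m_closed [OF subgroup_hgroup _ Gam_A.IH] by (simp add: \<phi>_mult)
next
  case (Gam_C g)
  have "\<phi> (adj gA) \<in> hgroup"
  proof -
    have "inv\<^bsub>GL 5\<^esub> (\<phi> gA) = \<phi> (adj gA)"
      by (rule \<phi>_inv) (simp_all add: gA_def one_mat5_def)
    moreover have "inv\<^bsub>GL 5\<^esub> (\<phi> gA) \<in> hgroup"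
      unfolding hgroup_eq by (rule generate.inv) simp
    ultimately show ?thesis by simp
  qed
  moreover have "\<phi> (gA * gC) \<in> hgroup" unfolding hgroup_eq by (rule generate.incl) simp
  ultimately have "\<phi> (adj gA * (gA * gC)) \<in> hgroup"
    using subgroup.m_closed [OF subgroup_hgroup] by (simp add: \<phi>_mult del: times_mat5.simps)
  moreover have "adj gA * (gA * gC) = gC" by (simp add: gA_def gC_def)
  ultimately have "\<phi> gC \<in> hgroup" by simp
  then show ?case
    using subgroup.m_closed [OF subgroup_hgroup _ Gam_C.IH] by (simp add: \<phi>_mult)
qed

text \<open>Every isometry is \<open>\<gamma> * y\<close> with \<gamma> in \<open>Gam\<close> and y
  in a finite set; the image of \<gamma> lies in the group, so the coset depends on y only.\<close>

lemma finite_index_Q0: "finite_index_subgroup hgroup (orthogonal_group_int 5 Q0)"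
proof -
  interpret GL: group "GL 5 :: complex mat monoid" by (rule group_GL)
  have G: "orthogonal_group_int 5 Q0 = (GL 5)\<lparr>carrier := \<phi> ` isom\<rparr>"
    by (simp add: orthogonal_group_int_def orthogonal_int_eq)
  obtain Y where Y: "finite Y" "\<And>g. g \<in> isom \<Longrightarrow> \<exists>\<gamma> \<in> Gam. \<exists>y \<in> Y. g = \<gamma> * y"
    using isom_finite_index by blast
  have "rcosets\<^bsub>orthogonal_group_int 5 Q0\<^esub> hgroup \<subseteq> (\<lambda>y. hgroup #>\<^bsub>GL 5\<^esub> \<phi> y) ` Y"
  proof
    fix X assume "X \<in> rcosets\<^bsub>orthogonal_group_int 5 Q0\<^esub> hgroup"
    then obtain g where g: "g \<in> isom" "X = hgroup #>\<^bsub>GL 5\<^esub> \<phi> g"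
      by (auto simp: G RCOSETS_def r_coset_def)
    obtain \<gamma> y where y: "\<gamma> \<in> Gam" "y \<in> Y" "g = \<gamma> * y" using Y(2) [OF g(1)] by blast
    obtain \<gamma>' where \<gamma>': "\<gamma>' \<in> Gam" "\<gamma> * \<gamma>' = 1" "\<gamma>' * \<gamma> = 1" using Gam_inverse [OF y(1)] by blast
    \<comment> \<open>Since \<open>Y\<close> may contain arbitrary matrices, invertibility of
      \<open>\<phi> y\<close> is obtained from \<open>\<gamma>' * g = y\<close>.\<close>
    have "\<phi> \<gamma>' \<in> carrier (GL 5)" using \<phi>_units [of \<gamma>' \<gamma>] \<gamma>' by blast
    moreover have "\<phi> g \<in> carrier (GL 5)" using g subgroup.subset [OF subgroup_isom] by blast
    moreover have "\<gamma>' * g = y" using y \<gamma>' by (metis mult.assoc mult_1_left)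
    ultimately have "\<phi> y \<in> carrier (GL 5)"
      using GL.m_closed [of "\<phi> \<gamma>'" "\<phi> g"] by (simp add: \<phi>_mult [symmetric])
    moreover have h: "\<phi> \<gamma> \<in> hgroup" by (rule Gam_hgroup [OF y(1)])
    moreover have "\<phi> \<gamma> \<in> carrier (GL 5)" using h subgroup.subset [OF subgroup_hgroup] by blast
    ultimately have "hgroup #>\<^bsub>GL 5\<^esub> \<phi> y = hgroup #>\<^bsub>GL 5\<^esub> \<phi> \<gamma> #>\<^bsub>GL 5\<^esub> \<phi> y"
      using GL.coset_join2 [OF _ subgroup_hgroup] by metis
    also have "\<dots> = hgroup #>\<^bsub>GL 5\<^esub> (\<phi> \<gamma> \<otimes>\<^bsub>GL 5\<^esub> \<phi> y)"
      using GL.coset_mult_assoc \<open>\<phi> y \<in> carrier (GL 5)\<close> \<open>\<phi> \<gamma> \<in> carrier (GL 5)\<close>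
        subgroup.subset [OF subgroup_hgroup] by blast
    also have "\<phi> \<gamma> \<otimes>\<^bsub>GL 5\<^esub> \<phi> y = \<phi> g" by (simp add: y \<phi>_mult)
    finally show "X \<in> (\<lambda>y. hgroup #>\<^bsub>GL 5\<^esub> \<phi> y) ` Y" using g y by auto
  qed
  then have "finite (rcosets\<^bsub>orthogonal_group_int 5 Q0\<^esub> hgroup)"
    using Y(1) by (meson finite_imageI finite_subset)
  moreover have "subgroup hgroup (orthogonal_group_int 5 Q0)"
    unfolding G by (rule GL.subgroup_incl [OF subgroup_hgroup subgroup_isom hgroup_subset])
  ultimately show ?thesis by (simp add: finite_index_subgroup_def)
qed

section \<open>Uniqueness and non-degeneracy of the invariant form\<close>

text \<open>A companion matrix sends each of the first four unit vectors to the next one, so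
  invariance makes the Gram matrix Toeplitz. The second equation pairs such a vector with the last
  column.\<close>

lemma preserved_form_equations:
  fixes X :: "rat mat"
  assumes X: "X \<in> carrier_mat 5 5" and g: "g = Mat e2 f1 f2 e0 (Vec a b c d e)"
    and eq: "transpose_mat (map_mat of_int (imat g)) * map_mat of_rat X * map_mat of_int (imat g) =
      (map_mat of_rat X :: complex mat)"
    and i: "i < 4"
  shows "j < 4 \<Longrightarrow> X $$ (Suc i, Suc j) = X $$ (i, j)"
    and "of_int a * X $$ (Suc i, 0) + of_int b * X $$ (Suc i, 1) + of_int c * X $$ (Suc i, 2) +
      of_int d * X $$ (Suc i, 3) + of_int e * X $$ (Suc i, 4) = X $$ (i, 4)"
proof -
  define G where "G = (map_mat of_int (imat g) :: rat mat)"
  have G: "G \<in> carrier_mat 5 5" by (simp add: G_def)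
  have "map_mat of_rat G = (map_mat of_int (imat g) :: complex mat)"
    by (subst mat5_eq_iff) (simp_all add: G_def imat_def)
  moreover have TG: "transpose_mat G \<in> carrier_mat 5 5" using G by simp
  ultimately have "map_mat of_rat (transpose_mat G * X * G) = (map_mat of_rat X :: complex mat)"
    using eq by (simp only: of_rat_hom.mat_hom_mult [OF mult_carrier_mat [OF TG X] G]
        of_rat_hom.mat_hom_mult [OF TG X] map_mat_transpose [symmetric])
  then have *: "transpose_mat G * X * G = X" by (rule of_rat_hom.mat_hom_inj)
  note prod = index_mult_5 [OF TG X] index_mult_5 [OF mult_carrier_mat [OF TG X] G]
  have i_cases: "i = 0 \<or> i = 1 \<or> i = 2 \<or> i = 3" using i by linarith
  have idx: "(transpose_mat G * X) $$ (i, k) = X $$ (Suc i, k)" if "k < 5" for k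
    using i_cases that
    by (elim disjE; subst prod(1); simp add: G_def imat_def g eval_nat_numeral)
  have eq: "X $$ (Suc i, 0) * G $$ (0, k) + X $$ (Suc i, 1) * G $$ (1, k) + X $$ (Suc i, 2) * G $$ (2, k) +
      X $$ (Suc i, 3) * G $$ (3, k) + X $$ (Suc i, 4) * G $$ (4, k) = X $$ (i, k)" if "k < 5" for k
    using prod(2) [of i k] idx [of 0] idx [of 1] idx [of 2] idx [of 3] idx [of 4] i that
    by (simp only: *)
  show "X $$ (Suc i, Suc j) = X $$ (i, j)" if "j < 4"
  proof -
    have "j = 0 \<or> j = 1 \<or> j = 2 \<or> j = 3" using that by linarith
    then show ?thesis
      using eq [of j] by (elim disjE) (simp_all add: G_def imat_def g eval_nat_numeral)
  qed
  show "of_int a * X $$ (Suc i, 0) + of_int b * X $$ (Suc i, 1) + of_int c * X $$ (Suc i, 2) +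
      of_int d * X $$ (Suc i, 3) + of_int e * X $$ (Suc i, 4) = X $$ (i, 4)"
    using eq [of 4] by (simp add: G_def imat_def g mult.commute)
qed

text \<open>A symmetric Toeplitz matrix has five unknowns. The last columns of the two generators,
  used for the row indices 0 and 1, give four independent linear equations, leaving a single
  scalar.\<close>

lemma invariant_form_unique:
  assumes Q: "Q \<in> carrier_mat 5 5" "transpose_mat Q = Q" and H: "hgroup \<subseteq> orthogonal_group 5 Q"
  obtains c where "Q = c \<cdot>\<^sub>m Q0"
proof -
  have "\<phi> gA \<in> hgroup" "\<phi> (gA * gC) \<in> hgroup"
    unfolding hgroup_eq by (rule generate.incl, simp)+
  then have pres: "transpose_mat (\<phi> gA) * map_mat of_rat Q * \<phi> gA = map_mat of_rat Q"
    "transpose_mat (\<phi> (gA * gC)) * map_mat of_rat Q * \<phi> (gA * gC) = map_mat of_rat Q"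
    using H by (auto simp: orthogonal_group_def)
  have A: "cob * gA * cob_inv = Mat e2 f1 f2 e0 (Vec 1 (-1) (-1) 1 1)"
    and B: "cob * (gA * gC) * cob_inv = Mat e2 f1 f2 e0 (Vec (-1) (-3) (-5) (-5) (-3))"
    by (simp_all add: cob_def cob_inv_def gA_def gC_def)
  note A_eqs = preserved_form_equations [OF Q(1) A pres(1) [unfolded \<phi>_def]]
  note B_eqs = preserved_form_equations [OF Q(1) B pres(2) [unfolded \<phi>_def]]
  define q where "q k = Q $$ (0, k)" for k
  have sym: "Q $$ (i, j) = Q $$ (j, i)" if "i < 5" "j < 5" for i j
    using that Q index_transpose_mat(1) [of i Q j] by simp
  have toeplitz: "Q $$ (i, j) = q (j - i)" if "i \<le> j" "j < 5" for i j
    using that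
  proof (induction i arbitrary: j)
    case 0
    then show ?case by (simp add: q_def)
  next
    case (Suc i)
    then obtain j' where "j = Suc j'" by (cases j) auto
    then show ?case using Suc A_eqs(1) [of i j'] by simp
  qed
  have ent: "Q $$ (i, j) = (if i \<le> j then q (j - i) else q (i - j))" if "i < 5" "j < 5" for i j
    using toeplitz [of i j] toeplitz [of j i] sym [of i j] that by auto
  have eqs: "q 1 - q 0 - q 1 + q 2 + q 3 = q 4" "q 2 - q 1 - q 0 + q 1 + q 2 = q 3"
    "- q 1 - 3 * q 0 - 5 * q 1 - 5 * q 2 - 3 * q 3 = q 4"
    "- q 2 - 3 * q 1 - 5 * q 0 - 5 * q 1 - 3 * q 2 = q 3"
    using A_eqs(2) [of 0] A_eqs(2) [of 1] B_eqs(2) [of 0] B_eqs(2) [of 1]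
    by (simp_all add: ent numeral_2_eq_2)
  then have q: "q 1 = q 0 / 19 * (-17)" "q 2 = q 0 / 19 * 10" "q 3 = q 0 / 19" "q 4 = q 0 / 19 * (-8)"
    by simp_all
  have "Q = (q 0 / 19) \<cdot>\<^sub>m Q0"
    using Q(1) by (subst mat5_eq_iff) (simp_all add: all_less_5 ent Q0_def imat_def Q5_def q q(1) [unfolded One_nat_def])
  then show thesis by (rule that)
qed

lemma orthogonal_group_smult:
  assumes "c \<noteq> 0" "X \<in> carrier_mat n n"
  shows "orthogonal_group n (c \<cdot>\<^sub>m X) = orthogonal_group n X"
proof -
  define Y :: "complex mat" where "Y = map_mat of_rat X"
  have Y: "Y \<in> carrier_mat n n" using assms by (simp add: Y_def)
  have "map_mat of_rat (c \<cdot>\<^sub>m X) = of_rat c \<cdot>\<^sub>m Y"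
    by (intro eq_matI) (simp_all add: Y_def of_rat_mult)
  moreover have "transpose_mat M * (of_rat c \<cdot>\<^sub>m Y) * M = of_rat c \<cdot>\<^sub>m (transpose_mat M * Y * M)"
    if "M \<in> carrier_mat n n" for M
    using that Y by (simp add: mult_smult_distrib [of _ n n _ n] mult_smult_assoc_mat [of _ n n _ n])
  moreover have "of_rat c \<cdot>\<^sub>m U = of_rat c \<cdot>\<^sub>m V \<longleftrightarrow> U = V" if "U \<in> carrier_mat n n" "V \<in> carrier_mat n n" for U V :: "complex mat"
  proof
    assume *: "of_rat c \<cdot>\<^sub>m U = of_rat c \<cdot>\<^sub>m V"
    show "U = V"
    proof (rule eq_matI)
      fix i j assume "i < dim_row V" "j < dim_col V"
      then show "U $$ (i, j) = V $$ (i, j)"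
        using arg_cong [OF *, of "\<lambda>Z. Z $$ (i, j)"] that assms(1) by simp
    qed (use that in auto)
  qed simp
  ultimately have "transpose_mat M * map_mat of_rat (c \<cdot>\<^sub>m X) * M = map_mat of_rat (c \<cdot>\<^sub>m X) \<longleftrightarrow>
      transpose_mat M * Y * M = Y" if "M \<in> carrier_mat n n" for M
    using Y that by (metis mult_carrier_mat transpose_carrier_mat)
  then show ?thesis
    unfolding orthogonal_group_def Y_def [symmetric] by (auto simp only: GL_carrier)
qed

lemma nondegenerate_Q0: "nondegenerate_form 5 Q0"
proof -
  have "transpose_mat Q0 = Q0"
    by (subst mat5_eq_iff) (simp_all add: all_less_5 Q0_def imat_def Q5_def)
  moreover have "det Q0 \<noteq> 0"
  proof
    assume "det Q0 = 0"
    have "transp cob * Q5 * cob = gram" by (rule gram_Q5)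
    \<comment> \<open>\<open>D\<close> is 9 times the inverse of \<open>gram\<close>, so
      \<open>cob * D * transp cob\<close> is 9 times the inverse of \<open>Q5\<close>; the product
      of the two integral determinants is then 9^5.\<close>
    define D where "D = Mat (Vec 0 0 1 0 0) (Vec 0 0 0 1 0) (Vec 1 0 0 0 0) (Vec 0 1 0 0 0)
        (Vec 0 0 0 0 9)"
    have "Q5 * (cob * D * transp cob) = Mat (Vec 9 0 0 0 0) (Vec 0 9 0 0 0) (Vec 0 0 9 0 0)
        (Vec 0 0 0 9 0) (Vec 0 0 0 0 9)"
      by (simp add: Q5_def cob_def D_def)
    then have "imat Q5 * imat (cob * D * transp cob) = 9 \<cdot>\<^sub>m 1\<^sub>m 5"
      unfolding imat_mult [symmetric]
      by (subst mat5_eq_iff) (simp_all add: all_less_5 imat_def del: times_mat5.simps)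
    then have "det (imat Q5) * det (imat (cob * D * transp cob)) = 9 ^ 5"
      by (simp add: det_mult [OF imat_carrier imat_carrier, symmetric] det_smult)
    moreover have "det (imat Q5) = 0"
      using \<open>det Q0 = 0\<close> by (simp add: Q0_def of_int_hom.hom_det)
    ultimately show False by simp
  qed
  ultimately show ?thesis by (simp add: nondegenerate_form_def)
qed

theorem theorem1p2:
  fixes \<alpha> \<beta> :: "complex list"
  assumes "\<alpha> = [0, 1/12, 5/12, 7/12, 11/12]"
    and "\<beta> = [1/2, 1/3, 1/3, 2/3, 2/3]"
  shows "hypergeometric_group \<alpha> \<beta> \<subseteq> GL_int 5 \<and>
    (\<exists>Q. nondegenerate_form 5 Q \<and> hypergeometric_group \<alpha> \<beta> \<subseteq> orthogonal_group 5 Q) \<and>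
    (\<forall>Q. nondegenerate_form 5 Q \<and> hypergeometric_group \<alpha> \<beta> \<subseteq> orthogonal_group 5 Q \<longrightarrow>
       finite_index_subgroup (hypergeometric_group \<alpha> \<beta>) (orthogonal_group_int 5 Q))"
proof (intro conjI allI impI)
  have sub: "hypergeometric_group \<alpha> \<beta> \<subseteq> orthogonal_group 5 Q0 \<inter> GL_int 5"
    using hgroup_subset unfolding assms orthogonal_int_eq .
  then show "hypergeometric_group \<alpha> \<beta> \<subseteq> GL_int 5" by blast
  show "\<exists>Q. nondegenerate_form 5 Q \<and> hypergeometric_group \<alpha> \<beta> \<subseteq> orthogonal_group 5 Q"
    using sub nondegenerate_Q0 by blast
  fix Q assume Q: "nondegenerate_form 5 Q \<and> hypergeometric_group \<alpha> \<beta> \<subseteq> orthogonal_group 5 Q"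
  then obtain c where c: "Q = c \<cdot>\<^sub>m Q0"
    using invariant_form_unique [of Q] by (auto simp: nondegenerate_form_def assms)
  have "c \<noteq> 0" using Q c carrier_matD(2) [OF Q0_carrier] by (auto simp: nondegenerate_form_def det_smult)
  then have "orthogonal_group_int 5 Q = orthogonal_group_int 5 Q0"
    by (simp add: orthogonal_group_int_def c orthogonal_group_smult)
  then show "finite_index_subgroup (hypergeometric_group \<alpha> \<beta>) (orthogonal_group_int 5 Q)"
    using finite_index_Q0 by (simp only: assms)
qed

end
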